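(* Let $\beta<0$ be fixed. As $\eta\to0^+$, the spectral gap satisfies $r(\beta,\eta)\sim\eta$, with the correction term $$r(\beta,\eta)-\eta\;\sim\;-\frac{\beta\sqrt{\eta}}{\sqrt{2\pi}}\,e^{-\frac{\beta^2}{2\eta}}\left[1+\beta e^{\frac{\beta^2}{2}}\int_{-\infty}^{\beta}e^{-\frac{u^2}{2}}\,du\right],$$ and hence $r(\beta,\eta)-\eta$ is exponentially small as $\eta\to0^+$.
   Context: For $\beta\in\mathbb{R}$, $\eta>0$, consider the Markov diffusion process on $\mathbb{R}$ whose transition density $p$ satisfies $\partial_t p=-\partial_x[a(x)p]+\partial_x^2p$, with $a(x)=-\beta-\eta x$ for $x\ge0$ and $a(x)=-\beta-x$ for $x\le 0$, $p(x,0)=\delta(x-x_0)$, $p$ and $\partial_xp$ continuous at $x=0$, and decay as $x\to\pm\infty$. Its spectral gap $r(\beta,\eta)$ is the smallest strictly positive $\lambda$ for which $-\psi''+V\psi=(\lambda+\frac12)\psi$ on $\mathbb{R}$ has a nonzero solution $\psi\in L^2(\mathbb{R})$ with $\psi,\psi'$ continuous at $0$, where $V(x)=\frac14(\beta+x)^2$ for $x<0$ and $V(x)=\frac14(\beta+\eta x)^2+\frac{1-\eta}2$ for $x>0$. Here $f\sim g$ means $f/g\to1$. *)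

theory Defs
  imports "HOL-Analysis.Analysis" "HOL-Library.Landau_Symbols"
begin

text \<open>The value chosen at \<open>x = 0\<close> is never used: the potential jumps there, and the
  eigenvalue equation below is only imposed for \<open>x \<noteq> 0\<close>.\<close>

definition potential :: "real \<Rightarrow> real \<Rightarrow> real \<Rightarrow> real" where
  "potential \<beta> \<eta> x =
     (if x < 0 then (\<beta> + x)^2 / 4 else (\<beta> + \<eta> * x)^2 / 4 + (1 - \<eta>) / 2)"

text \<open>A square-integrable solution of \<open>- \<psi>'' + V \<psi> = (lam + 1/2) \<psi>\<close>; \<open>\<psi>1\<close> is \<open>\<psi>'\<close> and
  \<open>\<psi>2\<close> is \<open>\<psi>''\<close> (away from \<open>0\<close>). Continuity of \<open>\<psi>\<close> at \<open>0\<close> follows from differentiability.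
  As \<open>lam\<close> and \<open>V\<close> are real, nothing is lost by taking \<open>\<psi>\<close> real-valued.\<close>

definition L2_solution :: "real \<Rightarrow> real \<Rightarrow> real \<Rightarrow> (real \<Rightarrow> real) \<Rightarrow> bool" where
  "L2_solution \<beta> \<eta> lam \<psi> \<longleftrightarrow>
     integrable lborel (\<lambda>x. (\<psi> x)^2) \<and>
     (\<exists>\<psi>1 \<psi>2.
        (\<forall>x. (\<psi> has_real_derivative \<psi>1 x) (at x)) \<and>
        isCont \<psi>1 0 \<and>
        (\<forall>x. x \<noteq> 0 \<longrightarrow> (\<psi>1 has_real_derivative \<psi>2 x) (at x)) \<and>
        (\<forall>x. x \<noteq> 0 \<longrightarrow> - \<psi>2 x + potential \<beta> \<eta> x * \<psi> x = (lam + 1/2) * \<psi> x))"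

definition spectral_gap :: "real \<Rightarrow> real \<Rightarrow> real" where
  "spectral_gap \<beta> \<eta> =
     (LEAST lam. 0 < lam \<and> (\<exists>\<psi>. L2_solution \<beta> \<eta> lam \<psi> \<and> (\<exists>x. \<psi> x \<noteq> 0)))"

end

theory Submission
  imports Defs "HOL-Probability.Probability" "HOL-Real_Asymp.Real_Asymp"
begin

text \<open>
  On each half-line the equation is a parabolic cylinder equation, of order \<open>\<nu> = lam / \<eta>\<close> in the
  variable \<open>(\<beta> + \<eta> x) / sqrt \<eta>\<close> on the right and of order \<open>lam\<close> in \<open>- \<beta> - x\<close> on the left. For
  \<open>lam < 2 \<eta> < 1\<close> the solutions decaying at infinity are combinations of the integrals
  \<open>K\<^sub>s(y) = \<integral>\<^sub>0\<^sup>\<infinity> t\<^bsup>s-1\<^esup> e\<^bsup>-yt-t\<^sup>2/2\<^esup> dt\<close> with \<open>s > 0\<close>, and a square-integrable solution has vanishing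
  Wronskian with them. Writing \<open>lam = \<eta> (1 + \<mu>)\<close> and \<open>z = - \<beta> / sqrt \<eta>\<close>, the matching
  condition at \<open>0\<close> becomes
  \<open>(K\<^bsub>2-\<mu>\<^esub>(-z) / K\<^bsub>1-\<mu>\<^esub>(-z) - z) K\<^bsub>2-lam\<^esub>(-\<beta>) / K\<^bsub>1-lam\<^esub>(-\<beta>) = sqrt \<eta> \<mu>\<close>.
  The ratios are monotone in \<open>\<mu>\<close>, so the difference of the two sides changes sign once on
  \<open>(-1, 1)\<close>, and only for \<open>\<mu> > 0\<close>. Evaluating that sign at \<open>\<mu> = \<kappa> E\<close>, where \<open>E\<close> is the
  claimed leading term, shows that the root lies below or above \<open>\<kappa> E\<close> according to whether
  \<open>\<kappa> > 1\<close> or \<open>\<kappa> < 1\<close>.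
\<close>

subsection \<open>Integrals of parabolic cylinder type\<close>

definition kern :: "real \<Rightarrow> real \<Rightarrow> real \<Rightarrow> real" where
  "kern s y t = t powr (s - 1) * exp (- y * t - t^2 / 2)"

text \<open>\<open>cyl_int s y\<close> is \<open>\<Gamma>(s) e\<^bsup>y\<^sup>2/4\<^esup> D\<^bsub>-s\<^esub>(y)\<close> for the parabolic cylinder function \<open>D\<close>.\<close>

definition cyl_int :: "real \<Rightarrow> real \<Rightarrow> real" where
  "cyl_int s y = (LINT t:{0<..}|lborel. kern s y t)"

lemma kern_nonneg: "0 \<le> kern s y t"
  by (simp add: kern_def)

lemma kern_shift: "t > 0 \<Longrightarrow> kern (s + 1) y t = t * kern s y t"
  by (simp add: kern_def powr_diff)

lemma kern_measurable [measurable]: "kern s y \<in> borel_measurable borel"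
  unfolding kern_def by measurable

lemma isCont_kern: "t > 0 \<Longrightarrow> isCont (kern s y) t"
  unfolding kern_def[abs_def] by (auto intro!: continuous_intros)

section \<open>Convergence, bounds and positivity\<close>

lemma nn_integral_powr_exp:
  fixes s :: real
  assumes "s > 0"
  shows "(\<integral>\<^sup>+t. ennreal (indicat_real {0<..} t *\<^sub>R (t powr (s - 1) * exp (- t))) \<partial>lborel) = Gamma s"
  unfolding Gamma_conv_nn_integral_real[OF assms]
  by (intro nn_integral_cong arg_cong[where f = ennreal])
     (auto simp: exp_minus field_simps split: split_indicator)

lemma powr_exp_integrable:
  assumes "s > 0"
  shows "set_integrable lborel {0<..} (\<lambda>t::real. t powr (s - 1) * exp (- t))"
  unfolding set_integrable_def
  by (rule integrableI_nonneg) (auto simp: nn_integral_powr_exp[OF assms, simplified])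

lemma integral_powr_exp:
  fixes s :: real
  assumes "s > 0"
  shows "(LINT t:{0<..}|lborel. t powr (s - 1) * exp (- t)) = Gamma s"
proof -
  have "(LINT t:{0<..}|lborel. t powr (s - 1) * exp (- t))
      = enn2real (\<integral>\<^sup>+t. ennreal (indicat_real {0<..} t *\<^sub>R (t powr (s - 1) * exp (- t))) \<partial>lborel)"
    unfolding set_lebesgue_integral_def by (rule integral_eq_nn_integral) auto
  then show ?thesis
    unfolding nn_integral_powr_exp[OF assms] using assms Gamma_real_pos[of s] by simp
qed

text \<open>Splitting off \<open>exp (- t)\<close> and completing the square bounds the rest of the
  exponent by its maximum. What remains is a Gamma integrand, with all dependence on y in a constant
  factor.\<close>

lemma kern_le: "kern s y t \<le> exp ((1 - y)^2 / 2) * (t powr (s - 1) * exp (- t))"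
proof -
  have "- y * t - t^2 / 2 = (1 - y)^2 / 2 - t - (t - (1 - y))^2 / 2"
    by (simp add: power2_eq_square field_simps)
  then have "exp (- y * t - t^2 / 2) \<le> exp ((1 - y)^2 / 2) * exp (- t)"
    by (simp flip: exp_add)
  then show ?thesis
    unfolding kern_def by (simp only: mult.left_commute) (intro mult_left_mono, auto)
qed

lemma kern_integrable:
  assumes "s > 0"
  shows "set_integrable lborel {0<..} (kern s y)"
proof (rule set_integrable_bound)
  show "set_integrable lborel {0<..} (\<lambda>t. exp ((1 - y)^2 / 2) * (t powr (s - 1) * exp (- t)))"
    using powr_exp_integrable[OF assms] by simp
  show "AE t in lborel. t \<in> {0<..} \<longrightarrow> norm (kern s y t)
      \<le> norm (exp ((1 - y)^2 / 2) * (t powr (s - 1) * exp (- t)))"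
    using kern_le[of s y] kern_nonneg[of s y] by auto
qed (auto simp: set_borel_measurable_def)

lemma cyl_le:
  assumes "s > 0"
  shows "cyl_int s y \<le> exp ((1 - y)^2 / 2) * Gamma s"
proof -
  have "cyl_int s y \<le> (LINT t:{0<..}|lborel. exp ((1 - y)^2 / 2) * (t powr (s - 1) * exp (- t)))"
    unfolding cyl_int_def
    using kern_le
    by (intro set_integral_mono kern_integrable set_integrable_mult_right powr_exp_integrable assms)
  then show ?thesis
    by (simp add: integral_powr_exp[OF assms])
qed

lemma cyl_pos:
  assumes "s > 0"
  shows "cyl_int s y > 0"
proof -
  have "cyl_int s y \<noteq> 0"
  proof
    assume "cyl_int s y = 0"
    \<comment> \<open>The kernel is positive on (0, 1), so a vanishing integral would make that
      interval a null set.\<close>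
    then have "AE t in lborel. t \<notin> {0<..<1::real}"
      using kern_integrable[OF assms, of y] kern_nonneg[of s y]
      unfolding cyl_int_def set_lebesgue_integral_def set_integrable_def
      by (subst (asm) integral_nonneg_eq_0_iff_AE) (auto simp: kern_def split: split_indicator_asm elim!: eventually_mono)
    then have "{0<..<1::real} \<in> null_sets lborel"
      by (subst AE_iff_null_sets) auto
    from null_setsD1[OF this] show False by simp
  qed
  moreover have "cyl_int s y \<ge> 0"
    unfolding cyl_int_def set_lebesgue_integral_def
    by (intro Bochner_Integration.integral_nonneg) (auto simp: kern_nonneg)
  ultimately show ?thesis by simp
qed

section \<open>Differentiation under the integral sign\<close>

lemma exp_remainder:
  fixes u :: real
  shows "0 \<le> exp u - 1 - u" "exp u - 1 - u \<le> u^2 * exp \<bar>u\<bar>"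
proof -
  show "0 \<le> exp u - 1 - u"
    using exp_ge_add_one_self[of u] by linarith
  \<comment> \<open>This gives exp u - 1 <= u exp u, so the remainder is at most u (exp u - 1),
    which is estimated next.\<close>
  have 1: "exp u * (1 - u) \<le> 1"
  proof -
    have "exp u * (1 - u) \<le> exp u * exp (- u)"
      using exp_ge_add_one_self[of "- u"] by (intro mult_left_mono) auto
    then show ?thesis by (simp flip: exp_add)
  qed
  have 2: "u * (exp u - 1) \<le> u^2 * exp \<bar>u\<bar>"
  proof (cases "u \<ge> 0")
    case True
    have "exp u - 1 \<le> u * exp u" using 1 by (simp add: algebra_simps)
    then show ?thesis using True mult_left_mono[of "exp u - 1" "u * exp u" u]
      by (simp add: power2_eq_square mult.assoc)
  next
    case False
    have "(- u) * (1 - exp u) \<le> (- u) * (- u)"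
      using False exp_ge_add_one_self[of u] by (intro mult_left_mono) linarith+
    also have "\<dots> \<le> u^2 * exp \<bar>u\<bar>"
      by (simp add: power2_eq_square mult_le_cancel_left1)
    finally show ?thesis by (simp add: algebra_simps)
  qed
  show "exp u - 1 - u \<le> u^2 * exp \<bar>u\<bar>"
    using 1 2 by (simp add: algebra_simps)
qed

text \<open>A uniform second-order remainder bound yields the derivative at once and takes the place
  of a dominated convergence argument for \<open>cyl_int\<close>.\<close>

lemma has_real_derivative_quadratic_error:
  fixes f :: "real \<Rightarrow> real"
  assumes "\<And>h. \<bar>h\<bar> \<le> 1 \<Longrightarrow> \<bar>f (y + h) - f y - h * D\<bar> \<le> C * h^2"
  shows "(f has_real_derivative D) (at y)"
  unfolding DERIV_def
proof (subst LIM_zero_iff[symmetric], rule Lim_null_comparison)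
  show "\<forall>\<^sub>F h in at 0. norm ((f (y + h) - f y) / h - D) \<le> C * \<bar>h\<bar>"
    unfolding eventually_at
  proof (intro exI[of _ 1] conjI ballI impI)
    fix h :: real assume h: "h \<noteq> 0 \<and> dist h 0 < 1"
    have "(f (y + h) - f y) / h - D = (f (y + h) - f y - h * D) / h"
      using h by (simp add: field_simps)
    then have "\<bar>(f (y + h) - f y) / h - D\<bar> = \<bar>f (y + h) - f y - h * D\<bar> / \<bar>h\<bar>"
      by simp
    also have "\<dots> \<le> C * h^2 / \<bar>h\<bar>"
      using assms[of h] h by (intro divide_right_mono) auto
    also have "\<dots> = C * \<bar>h\<bar>"
      using h by (simp add: field_simps power2_eq_square)
    finally show "norm ((f (y + h) - f y) / h - D) \<le> C * \<bar>h\<bar>"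
      by simp
  qed simp
  show "((\<lambda>h. C * \<bar>h\<bar>) \<longlongrightarrow> 0) (at 0)"
    by (auto intro!: tendsto_eq_intros)
qed

text \<open>Differentiating the kernel in y brings down a factor -t, which raises the order by
  one.\<close>

lemma cyl_deriv:
  assumes s: "s > 0"
  shows "(cyl_int s has_real_derivative - cyl_int (s + 1) y) (at y)"
proof (rule has_real_derivative_quadratic_error)
  fix h :: real assume h: "\<bar>h\<bar> \<le> 1"
  have int: "set_integrable lborel {0<..} (kern s y')" "set_integrable lborel {0<..} (kern (s + 1) y')"
    "set_integrable lborel {0<..} (kern (s + 2) y')" for y'
    using kern_integrable s by simp_all
  let ?r = "\<lambda>t. kern s (y + h) t - kern s y t + h * kern (s + 1) y t"
  have r_int: "set_integrable lborel {0<..} ?r"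
    by (intro set_integral_add set_integral_diff set_integrable_mult_right int)
  have r: "(LINT t:{0<..}|lborel. ?r t) = cyl_int s (y + h) - cyl_int s y + h * cyl_int (s + 1) y"
    unfolding cyl_int_def using int by (simp add: set_integral_add set_integral_diff)
  \<comment> \<open>The factor t^2 of the Taylor remainder is absorbed as two extra orders, and the
    growth exp t, available because \<bar>h\<bar> <= 1, by moving y to y - 1.\<close>
  have pt: "0 \<le> ?r t \<and> ?r t \<le> h^2 * kern (s + 2) (y - 1) t" if "t > 0" for t
  proof -
    have "exp (- (y - 1) * t - t^2 / 2) = exp (- y * t - t^2 / 2) * exp t"
      "exp (- (y + h) * t - t^2 / 2) = exp (- y * t - t^2 / 2) * exp (- h * t)"
      unfolding exp_add[symmetric] by (simp_all add: algebra_simps)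
    then have p: "kern (s + 1) y t = t * kern s y t" "kern (s + 2) (y - 1) t = t^2 * (kern s y t * exp t)"
      "kern s (y + h) t = kern s y t * exp (- h * t)"
      using that by (simp_all add: kern_def powr_diff powr_add power2_eq_square)
    have e: "?r t = kern s y t * (exp (- h * t) - 1 - (- h * t))"
      unfolding p by (simp add: algebra_simps)
    have "?r t \<le> kern s y t * ((- h * t)^2 * exp \<bar>- h * t\<bar>)"
      unfolding e by (intro mult_left_mono exp_remainder kern_nonneg)
    also have "\<dots> \<le> kern s y t * ((- h * t)^2 * exp t)"
      using h that by (intro mult_left_mono kern_nonneg) (auto simp: abs_mult)
    also have "\<dots> = h^2 * kern (s + 2) (y - 1) t"
      unfolding p by (simp add: algebra_simps power_mult_distrib)
    finally show ?thesis
      unfolding e using exp_remainder(1)[of "- h * t"] kern_nonneg by (intro conjI mult_nonneg_nonneg)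
  qed
  have "0 \<le> (LINT t:{0<..}|lborel. ?r t)"
    unfolding set_lebesgue_integral_def using pt by (intro Bochner_Integration.integral_nonneg) (auto split: split_indicator)
  moreover have "(LINT t:{0<..}|lborel. ?r t) \<le> (LINT t:{0<..}|lborel. h^2 * kern (s + 2) (y - 1) t)"
    using pt by (intro set_integral_mono r_int set_integrable_mult_right int) auto
  moreover have "(LINT t:{0<..}|lborel. h^2 * kern (s + 2) (y - 1) t) = cyl_int (s + 2) (y - 1) * h^2"
    unfolding cyl_int_def set_integral_mult_right by (rule mult.commute)
  ultimately have "0 \<le> cyl_int s (y + h) - cyl_int s y + h * cyl_int (s + 1) y"
    "cyl_int s (y + h) - cyl_int s y + h * cyl_int (s + 1) y \<le> cyl_int (s + 2) (y - 1) * h^2"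
    unfolding r by linarith+
  then show "\<bar>cyl_int s (y + h) - cyl_int s y - h * - cyl_int (s + 1) y\<bar> \<le> cyl_int (s + 2) (y - 1) * h^2"
    by simp
qed

section \<open>Dependence on the order\<close>

lemma cyl_convex: "convex_on {0<..} (\<lambda>s. cyl_int s y)"
proof (rule convex_onI)
  fix u x s :: real
  assume u: "0 < u" "u < 1" and xs: "x \<in> {0<..}" "s \<in> {0<..}"
  have pos: "(1 - u) * x + u * s > 0"
    using u xs by (intro add_pos_pos) auto
  have "cyl_int ((1 - u) * x + u * s) y
      \<le> (LINT t:{0<..}|lborel. (1 - u) * kern x y t + u * kern s y t)"
    unfolding cyl_int_def
  proof (intro set_integral_mono set_integral_add set_integrable_mult_right kern_integrable)
    fix t :: real assume "t \<in> {0<..}"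
    then have t: "t > 0" by simp
    \<comment> \<open>For fixed t the power is the exponential of an affine function of the order,
      so convexity holds pointwise and survives integration.\<close>
    have "exp ((1 - u) *\<^sub>R ((x - 1) * ln t) + u *\<^sub>R ((s - 1) * ln t))
       \<le> (1 - u) * exp ((x - 1) * ln t) + u * exp ((s - 1) * ln t)"
      using u by (intro convex_onD[OF exp_convex]) auto
    then have "t powr ((1 - u) * x + u * s - 1) \<le> (1 - u) * t powr (x - 1) + u * t powr (s - 1)"
      using t by (simp add: powr_def algebra_simps)
    then have "t powr ((1 - u) * x + u * s - 1) * exp (- y * t - t^2 / 2)
        \<le> ((1 - u) * t powr (x - 1) + u * t powr (s - 1)) * exp (- y * t - t^2 / 2)"
      by (intro mult_right_mono) auto
    then show "kern ((1 - u) * x + u * s) y t \<le> (1 - u) * kern x y t + u * kern s y t"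
      by (simp add: kern_def algebra_simps)
  qed (use pos xs in auto)
  also have "\<dots> = (1 - u) * cyl_int x y + u * cyl_int s y"
    unfolding cyl_int_def
    using xs by (subst set_integral_add) (auto intro!: set_integrable_mult_right kern_integrable)
  finally show "cyl_int ((1 - u) *\<^sub>R x + u *\<^sub>R s) y \<le> (1 - u) * cyl_int x y + u * cyl_int s y"
    by simp
qed auto

lemma isCont_cyl_order:
  assumes "s > 0"
  shows "isCont (\<lambda>s. cyl_int s y) s"
  using convex_on_continuous[OF _ cyl_convex, of y] assms
  by (auto simp: continuous_on_eq_continuous_at)

text \<open>A Chebyshev-type inequality: with \<open>m\<close> the mean of \<open>t\<close> under \<open>kern s y\<close>, integrate
  \<open>(t - m) (t\<^bsup>r-s\<^esup> - m\<^bsup>r-s\<^esup>) \<ge> 0\<close>.\<close>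

lemma cyl_ratio_mono:
  assumes "0 < s" "s < r"
  shows "cyl_int (s + 1) y / cyl_int s y \<le> cyl_int (r + 1) y / cyl_int r y"
proof -
  define m where "m = cyl_int (s + 1) y / cyl_int s y"
  have K: "cyl_int s y > 0" "cyl_int (s + 1) y > 0" "cyl_int r y > 0"
    using assms by (auto intro!: cyl_pos)
  have m: "m > 0" unfolding m_def using K by simp
  let ?c = "m powr (r - s)"
  let ?f = "\<lambda>t. (kern (r + 1) y t - m * kern r y t) - ?c * (kern (s + 1) y t - m * kern s y t)"
  have "0 \<le> (LINT t:{0<..}|lborel. ?f t)"
    unfolding set_lebesgue_integral_def
  proof (intro Bochner_Integration.integral_nonneg)
    fix t :: real
    have "0 \<le> ?f t" if t: "t > 0"
    proof -
      have p: "kern r y t = t powr (r - s) * kern s y t"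
        using t by (simp add: kern_def flip: powr_add)
      have "?f t = kern s y t * ((t - m) * (t powr (r - s) - ?c))"
        unfolding kern_shift[OF t] p by (simp add: algebra_simps)
      moreover have "0 \<le> (t - m) * (t powr (r - s) - ?c)"
      proof (cases "t \<ge> m")
        case True
        then show ?thesis using m assms by (intro mult_nonneg_nonneg) (auto intro!: powr_mono2)
      next
        case False
        then show ?thesis using m t assms by (intro mult_nonpos_nonpos) (auto intro!: powr_mono2)
      qed
      ultimately show ?thesis by (simp add: kern_nonneg)
    qed
    then show "0 \<le> indicat_real {0<..} t *\<^sub>R ?f t" by (auto split: split_indicator)
  qed
  also have "(LINT t:{0<..}|lborel. ?f t) = (cyl_int (r + 1) y - m * cyl_int r y) - ?c * (cyl_int (s + 1) y - m * cyl_int s y)"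
    unfolding cyl_int_def using assms
    by (simp add: set_integral_diff kern_integrable)
  also have "cyl_int (s + 1) y - m * cyl_int s y = 0"
    unfolding m_def using K by simp
  finally have "m * cyl_int r y \<le> cyl_int (r + 1) y" by simp
  then show ?thesis
    unfolding m_def[symmetric] using K by (simp add: pos_le_divide_eq)
qed

section \<open>Recurrences between neighbouring orders\<close>

lemma cyl_rec:
  assumes "s > 0"
  shows "cyl_int (s + 2) y + y * cyl_int (s + 1) y = s * cyl_int s y"
proof -
  let ?w = "\<lambda>t::real. exp (- y * t - t^2 / 2)"
  let ?f = "\<lambda>t. (kern (s + 2) y t + y * kern (s + 1) y t) - s * kern s y t"
  have int: "set_integrable lborel {0<..} (kern s y)" "set_integrable lborel {0<..} (kern (s + 1) y)"
    "set_integrable lborel {0<..} (kern (s + 2) y)"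
    using kern_integrable assms by simp_all
  \<comment> \<open>The integrand is the derivative of -t^s exp (-y t - t^2/2), whose boundary
    values both vanish because s > 0.\<close>
  have "(LBINT t=ereal 0..\<infinity>. ?f t) = 0 - 0"
  proof (rule interval_integral_FTC_integrable)
    show "set_integrable lborel (einterval (ereal 0) \<infinity>) ?f"
      using int by (auto intro!: set_integral_add set_integral_diff set_integrable_mult_right)
    show "((\<lambda>t. - (t powr s * ?w t)) has_vector_derivative ?f t) (at t)" if "ereal 0 < ereal t" for t
    proof -
      have t: "t > 0" using that by simp
      show ?thesis
        unfolding has_real_derivative_iff_has_vector_derivative[symmetric] kern_def
        using t by (auto intro!: derivative_eq_intros simp: field_simps powr_diff powr_add power2_eq_square)
    qed
    show "(((\<lambda>t. - (t powr s * ?w t)) \<circ> real_of_ereal) \<longlongrightarrow> 0) (at_right (ereal 0))"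
      unfolding ereal_tendsto_simps using assms by real_asymp
    show "(((\<lambda>t. - (t powr s * ?w t)) \<circ> real_of_ereal) \<longlongrightarrow> 0) (at_left \<infinity>)"
      unfolding ereal_tendsto_simps by real_asymp
  qed (auto intro!: continuous_intros isCont_kern)
  then have "(LINT t:{0<..}|lborel. ?f t) = 0"
    by (simp add: interval_lebesgue_integral_def)
  moreover have "(LINT t:{0<..}|lborel. ?f t) = (cyl_int (s + 2) y + y * cyl_int (s + 1) y) - s * cyl_int s y"
    unfolding cyl_int_def using int
    by (simp add: set_integral_add set_integral_diff)
  ultimately show ?thesis by simp
qed

text \<open>The limiting case s = 0 of \<open>cyl_rec\<close>: the boundary term at 0 no longer
  vanishes and contributes the 1.\<close>

lemma cyl_rec0: "cyl_int 2 y + y * cyl_int 1 y = 1"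
proof -
  let ?w = "\<lambda>t::real. exp (- y * t - t^2 / 2)"
  let ?f = "\<lambda>t. kern 2 y t + y * kern 1 y t"
  have int: "set_integrable lborel {0<..} (kern 2 y)" "set_integrable lborel {0<..} (kern 1 y)"
    using kern_integrable by simp_all
  have "(LBINT t=ereal 0..\<infinity>. ?f t) = 0 - (- 1)"
  proof (rule interval_integral_FTC_integrable)
    show "set_integrable lborel (einterval (ereal 0) \<infinity>) ?f"
      using int by (auto intro!: set_integral_add set_integrable_mult_right)
    show "((\<lambda>t. - ?w t) has_vector_derivative ?f t) (at t)" if "ereal 0 < ereal t" for t
      unfolding has_real_derivative_iff_has_vector_derivative[symmetric] kern_def
      using that by (auto intro!: derivative_eq_intros simp: field_simps)
    show "(((\<lambda>t. - ?w t) \<circ> real_of_ereal) \<longlongrightarrow> - 1) (at_right (ereal 0))"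
      unfolding ereal_tendsto_simps by real_asymp
    show "(((\<lambda>t. - ?w t) \<circ> real_of_ereal) \<longlongrightarrow> 0) (at_left \<infinity>)"
      unfolding ereal_tendsto_simps by real_asymp
  qed (auto intro!: continuous_intros isCont_kern)
  then have "(LINT t:{0<..}|lborel. ?f t) = 1"
    by (simp add: interval_lebesgue_integral_def)
  moreover have "(LINT t:{0<..}|lborel. ?f t) = cyl_int 2 y + y * cyl_int 1 y"
    unfolding cyl_int_def using int by (simp add: set_integral_add)
  ultimately show ?thesis by simp
qed

lemma cyl_antimono:
  assumes "s > 0" "y0 \<le> y"
  shows "cyl_int s y \<le> cyl_int s y0"
proof (rule DERIV_nonpos_imp_nonincreasing[OF assms(2)])
  show "\<exists>d. (cyl_int s has_real_derivative d) (at x) \<and> d \<le> 0" for x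
    using cyl_deriv[OF assms(1), of x] cyl_pos[of "s + 1" x] assms(1)
    by (intro exI[of _ "- cyl_int (s + 1) x"]) auto
qed

text \<open>For s > 1 the recurrence turns this into \<open>(s - 1) * cyl_int (s - 1) y\<close>. The
  present form continues that product to 0 < s <= 1, where the integral of order s - 1 diverges.
  With s = 2 - \<nu> this covers the orders \<nu> in [1, 2).\<close>

definition cyl_A :: "real \<Rightarrow> real \<Rightarrow> real" where
  "cyl_A s y = cyl_int (s + 1) y + y * cyl_int s y"

lemma cyl_A_eq: "s > 1 \<Longrightarrow> cyl_A s y = (s - 1) * cyl_int (s - 1) y"
  using cyl_rec[of "s - 1" y] by (simp add: cyl_A_def add.commute)

lemma cyl_A_1: "cyl_A 1 y = 1"
  using cyl_rec0[of y] by (simp add: cyl_A_def)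

lemma cyl_A_deriv:
  assumes "s > 0"
  shows "(cyl_A s has_real_derivative (1 - s) * cyl_int s y) (at y)"
proof -
  have "((\<lambda>y. cyl_int (s + 1) y + y * cyl_int s y) has_real_derivative
      (- cyl_int (s + 1 + 1) y + (1 * cyl_int s y + - cyl_int (s + 1) y * y))) (at y)"
    using assms by (intro DERIV_add DERIV_mult DERIV_ident cyl_deriv) auto
  also have "- cyl_int (s + 1 + 1) y + (1 * cyl_int s y + - cyl_int (s + 1) y * y) = (1 - s) * cyl_int s y"
    using cyl_rec[OF assms, of y] by (simp add: algebra_simps)
  finally show ?thesis
    unfolding cyl_A_def[abs_def] .
qed

text \<open>\<open>cyl_U \<nu>\<close> is \<open>\<Gamma>(2 - \<nu>)\<close> times the Hermite function of order \<open>\<nu>\<close>; unlike \<open>cyl_int (- \<nu>)\<close>, this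
  expression converges for all orders \<open>\<nu> < 2\<close>.\<close>

definition cyl_U :: "real \<Rightarrow> real \<Rightarrow> real" where
  "cyl_U \<nu> y = y * cyl_A (2 - \<nu>) y - (\<nu> - 1) * cyl_int (2 - \<nu>) y"

text \<open>Together with \<open>cyl_A_deriv\<close> this makes \<open>cyl_U \<nu>\<close> a
  solution of the Hermite equation U'' - y U' + \<nu> U = 0.\<close>

lemma cyl_U_deriv:
  assumes "\<nu> < 2"
  shows "(cyl_U \<nu> has_real_derivative \<nu> * cyl_A (2 - \<nu>) y) (at y)"
proof -
  have "((\<lambda>y. y * cyl_A (2 - \<nu>) y - (\<nu> - 1) * cyl_int (2 - \<nu>) y) has_real_derivative
      (1 * cyl_A (2 - \<nu>) y + (1 - (2 - \<nu>)) * cyl_int (2 - \<nu>) y * y - (\<nu> - 1) * - cyl_int (2 - \<nu> + 1) y)) (at y)"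
    using assms by (intro DERIV_diff DERIV_mult DERIV_cmult DERIV_ident cyl_A_deriv cyl_deriv) auto
  also have "1 * cyl_A (2 - \<nu>) y + (1 - (2 - \<nu>)) * cyl_int (2 - \<nu>) y * y - (\<nu> - 1) * - cyl_int (2 - \<nu> + 1) y
      = \<nu> * cyl_A (2 - \<nu>) y"
    by (simp add: cyl_A_def algebra_simps)
  finally show ?thesis
    unfolding cyl_U_def[abs_def] .
qed

section \<open>Parabolic cylinder functions of order below 2\<close>

definition cyl_D :: "real \<Rightarrow> real \<Rightarrow> real" where
  "cyl_D \<nu> y = exp (- (y^2 / 4)) * cyl_U \<nu> y"

definition cyl_D' :: "real \<Rightarrow> real \<Rightarrow> real" where
  "cyl_D' \<nu> y = exp (- (y^2 / 4)) * (\<nu> * cyl_A (2 - \<nu>) y - y / 2 * cyl_U \<nu> y)"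

lemma cyl_D_deriv:
  assumes "\<nu> < 2"
  shows "(cyl_D \<nu> has_real_derivative cyl_D' \<nu> y) (at y)"
  unfolding cyl_D_def[abs_def] cyl_D'_def
  using assms by (auto intro!: derivative_eq_intros cyl_U_deriv simp: algebra_simps)

text \<open>The Gaussian factor removes the first-order term of the Hermite equation, which leaves
  Weber's equation; \<open>cyl_D \<nu>\<close> is \<Gamma>(2 - \<nu>) times the parabolic cylinder
  function of order \<nu>.\<close>

lemma cyl_D'_deriv:
  assumes "\<nu> < 2"
  shows "(cyl_D' \<nu> has_real_derivative (y^2 / 4 - 1 / 2 - \<nu>) * cyl_D \<nu> y) (at y)"
proof -
  have alg: "- (y / 2) * e * (\<nu> * A - y / 2 * U) + (\<nu> * ((1 - (2 - \<nu>)) * K) - (1 / 2 * U + \<nu> * A * (y / 2))) * e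
      = (y * y / 4 - 1 / 2) * U * e - \<nu> * (y * A - (\<nu> - 1) * K) * e" for e A K U :: real
    by (simp add: field_simps)
  let ?e = "exp (- (y^2 / 4))" and ?A = "cyl_A (2 - \<nu>) y" and ?K = "cyl_int (2 - \<nu>) y"
  have U: "cyl_U \<nu> y = y * ?A - (\<nu> - 1) * ?K"
    by (simp add: cyl_U_def)
  have e: "((\<lambda>y. exp (- (y^2 / 4))) has_real_derivative (- (y / 2) * ?e)) (at y)"
    by (auto intro!: derivative_eq_intros)
  have "((\<lambda>y. \<nu> * cyl_A (2 - \<nu>) y - y / 2 * cyl_U \<nu> y) has_real_derivative
      \<nu> * ((1 - (2 - \<nu>)) * ?K) - (1 / 2 * cyl_U \<nu> y + \<nu> * ?A * (y / 2))) (at y)"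
    using assms by (intro DERIV_diff DERIV_cmult DERIV_mult cyl_A_deriv cyl_U_deriv DERIV_cdivide DERIV_ident) auto
  from DERIV_mult[OF e this]
  have "(cyl_D' \<nu> has_real_derivative - (y / 2) * ?e * (\<nu> * ?A - y / 2 * cyl_U \<nu> y) +
      (\<nu> * ((1 - (2 - \<nu>)) * ?K) - (1 / 2 * cyl_U \<nu> y + \<nu> * ?A * (y / 2))) * ?e) (at y)"
    unfolding cyl_D'_def[abs_def] .
  also have "- (y / 2) * ?e * (\<nu> * ?A - y / 2 * cyl_U \<nu> y) +
      (\<nu> * ((1 - (2 - \<nu>)) * ?K) - (1 / 2 * cyl_U \<nu> y + \<nu> * ?A * (y / 2))) * ?e
      = (y * y / 4 - 1 / 2) * cyl_U \<nu> y * ?e - \<nu> * (y * ?A - (\<nu> - 1) * ?K) * ?e"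
    by (rule alg)
  also have "\<dots> = (y^2 / 4 - 1 / 2 - \<nu>) * cyl_D \<nu> y"
    unfolding U[symmetric] cyl_D_def by (simp add: power2_eq_square algebra_simps)
  finally show ?thesis .
qed

text \<open>\<open>cyl_int\<close> decreases in y, so \<open>cyl_U\<close> grows at most
  quadratically to the right of y0 and the Gaussian wins. The rate exp (- y) is merely a convenient
  integrable one.\<close>

lemma cyl_D_sq_le:
  assumes "\<nu> < 2"
  shows "\<exists>C. \<forall>y\<ge>y0. (cyl_D \<nu> y)^2 \<le> C * exp (- y)"
proof -
  define k0 k1 where "k0 = cyl_int (2 - \<nu>) y0" and "k1 = cyl_int (2 - \<nu> + 1) y0"
  define c where "c = k1 + k0 + \<bar>\<nu> - 1\<bar> * k0"
  have k: "k0 > 0" "k1 > 0"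
    unfolding k0_def k1_def using assms by (auto intro!: cyl_pos)
  then have c: "c \<ge> 0" by (auto simp: c_def)
  have "(cyl_D \<nu> y)^2 \<le> (c^2 * exp (25 / 2)) * exp (- y)" if y: "y \<ge> y0" for y
  proof -
    \<comment> \<open>A single majorant for 1, \<bar>y\<bar> and y^2.\<close>
    let ?e = "exp \<bar>y\<bar> ^ 2"
    have e1: "1 \<le> ?e" by simp
    have e2: "\<bar>y\<bar> * \<bar>y\<bar> \<le> ?e"
      unfolding power2_eq_square
      using exp_ge_add_one_self[of "\<bar>y\<bar>"] by (intro mult_mono) linarith+
    have e3: "\<bar>y\<bar> \<le> ?e"
    proof -
      have "\<bar>y\<bar> \<le> exp \<bar>y\<bar>" using exp_ge_add_one_self[of "\<bar>y\<bar>"] by linarith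
      also have "\<dots> \<le> ?e" unfolding power2_eq_square by (simp add: mult_le_cancel_left1)
      finally show ?thesis .
    qed
    have K: "\<bar>cyl_int (2 - \<nu>) y\<bar> \<le> k0" "\<bar>cyl_int (2 - \<nu> + 1) y\<bar> \<le> k1"
      unfolding k0_def k1_def
      using cyl_antimono[OF _ y, of "2 - \<nu>"] cyl_antimono[OF _ y, of "2 - \<nu> + 1"]
        cyl_pos[of "2 - \<nu>" y] cyl_pos[of "2 - \<nu> + 1" y] assms by auto
    have "\<bar>cyl_U \<nu> y\<bar> \<le> \<bar>y\<bar> * (\<bar>cyl_int (2 - \<nu> + 1) y\<bar> + \<bar>y\<bar> * \<bar>cyl_int (2 - \<nu>) y\<bar>) + \<bar>\<nu> - 1\<bar> * \<bar>cyl_int (2 - \<nu>) y\<bar>"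
      unfolding cyl_U_def cyl_A_def
      using abs_triangle_ineq4[of "y * (cyl_int (2 - \<nu> + 1) y + y * cyl_int (2 - \<nu>) y)" "(\<nu> - 1) * cyl_int (2 - \<nu>) y"]
        mult_left_mono[OF abs_triangle_ineq[of "cyl_int (2 - \<nu> + 1) y" "y * cyl_int (2 - \<nu>) y"], of "\<bar>y\<bar>"]
      by (simp add: abs_mult)
    also have "\<dots> \<le> \<bar>y\<bar> * (k1 + \<bar>y\<bar> * k0) + \<bar>\<nu> - 1\<bar> * k0"
      using K by (intro add_mono mult_left_mono) auto
    also have "\<dots> = k1 * \<bar>y\<bar> + k0 * (\<bar>y\<bar> * \<bar>y\<bar>) + \<bar>\<nu> - 1\<bar> * k0 * 1"
      by (simp add: algebra_simps)
    also have "\<dots> \<le> k1 * ?e + k0 * ?e + \<bar>\<nu> - 1\<bar> * k0 * ?e"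
      using e1 e2 e3 k by (intro add_mono mult_left_mono) auto
    also have "\<dots> = c * ?e" by (simp add: c_def algebra_simps)
    finally have U: "\<bar>cyl_U \<nu> y\<bar> \<le> c * ?e" .
    have "(cyl_U \<nu> y)^2 = \<bar>cyl_U \<nu> y\<bar>^2" by simp
    also have "\<dots> \<le> (c * ?e)^2"
      using U by (intro power_mono) auto
    finally have U2: "(cyl_U \<nu> y)^2 \<le> (c * ?e)^2" .
    \<comment> \<open>Squaring the bound produces exp (4 \<bar>y\<bar>), one more \<bar>y\<bar> pays
      for exp (- y), and 25/2 is the maximum of 5 \<bar>y\<bar> - y^2/2.\<close>
    have "- (y^2 / 2) + 4 * \<bar>y\<bar> \<le> 25 / 2 - y"
    proof -
      have "- (y^2 / 2) + 5 * \<bar>y\<bar> = 25 / 2 - (\<bar>y\<bar> - 5)^2 / 2"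
        by (simp add: power2_eq_square field_simps)
      moreover have "(\<bar>y\<bar> - 5)^2 / 2 \<ge> 0" by simp
      ultimately show ?thesis by linarith
    qed
    then have ex: "exp (- (y^2 / 2)) * exp (4 * \<bar>y\<bar>) \<le> exp (25 / 2) * exp (- y)"
      by (simp flip: exp_add)
    have "(cyl_D \<nu> y)^2 = exp (- (y^2 / 2)) * (cyl_U \<nu> y)^2"
      unfolding cyl_D_def power_mult_distrib exp_double[symmetric] by simp
    also have "\<dots> \<le> exp (- (y^2 / 2)) * (c * ?e)^2"
      using U2 by (intro mult_left_mono) auto
    also have "\<dots> = c^2 * (exp (- (y^2 / 2)) * exp (4 * \<bar>y\<bar>))"
      by (simp add: power_mult_distrib flip: exp_of_nat_mult)
    also have "\<dots> \<le> c^2 * (exp (25 / 2) * exp (- y))"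
      using ex by (intro mult_left_mono) auto
    finally show ?thesis by (simp add: mult.assoc)
  qed
  then show ?thesis by blast
qed

lemma exp_decay_integrable:
  fixes q :: real
  assumes "q > 0"
  shows "set_integrable lborel {0..} (\<lambda>x. exp (- (q * x)))"
proof -
  have "(\<integral>\<^sup>+x. ennreal (exp (- (q * x))) * indicator {0..} x \<partial>lborel) = 0 - (- (exp (- (q * 0)) / q))"
  proof (rule nn_integral_FTC_atLeast)
    show "((\<lambda>x. - (exp (- (q * x)) / q)) \<longlongrightarrow> 0) at_top"
      using assms by real_asymp
  qed (use assms in \<open>auto intro!: derivative_eq_intros\<close>)
  also have "(\<integral>\<^sup>+x. ennreal (exp (- (q * x))) * indicator {0..} x \<partial>lborel)
      = (\<integral>\<^sup>+x. ennreal (indicator {0..} x *\<^sub>R exp (- (q * x))) \<partial>lborel)"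
    by (intro nn_integral_cong) (auto split: split_indicator)
  finally show ?thesis
    unfolding set_integrable_def by (intro integrableI_nonneg) auto
qed

lemma cyl_D_affine_L2:
  assumes "\<nu> < 2" "q > 0"
  shows "set_integrable lborel {0..} (\<lambda>x. (cyl_D \<nu> (p + q * x))^2)"
proof -
  obtain C where C: "\<forall>y\<ge>p. (cyl_D \<nu> y)^2 \<le> C * exp (- y)"
    using cyl_D_sq_le[OF assms(1)] by blast
  have [measurable]: "cyl_D \<nu> \<in> borel_measurable borel"
    by (intro borel_measurable_continuous_onI continuous_at_imp_continuous_on ballI)
       (rule DERIV_isCont[OF cyl_D_deriv[OF assms(1)]])
  show ?thesis
  proof (rule set_integrable_bound)
    show "set_integrable lborel {0..} (\<lambda>x. (C * exp (- p)) * exp (- (q * x)))"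
      using exp_decay_integrable[OF assms(2)] by simp
    show "set_borel_measurable lborel {0..} (\<lambda>x. (cyl_D \<nu> (p + q * x))^2)"
      unfolding set_borel_measurable_def by measurable
    have "(cyl_D \<nu> (p + q * x))^2 \<le> \<bar>C * exp (- p) * exp (- (q * x))\<bar>" if "x \<ge> 0" for x
    proof -
      have "(cyl_D \<nu> (p + q * x))^2 \<le> C * exp (- (p + q * x))"
        using C[rule_format, of "p + q * x"] that assms by simp
      also have "\<dots> = C * exp (- p) * exp (- (q * x))"
        by (simp add: exp_diff exp_minus field_simps exp_add)
      finally show ?thesis by linarith
    qed
    then show "AE x in lborel. x \<in> {0..} \<longrightarrow> norm ((cyl_D \<nu> (p + q * x))^2) \<le> norm (C * exp (- p) * exp (- (q * x)))"
      by auto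
  qed
qed

subsection \<open>Second-order equations on a half-line\<close>

text \<open>The equation f'' = q f is imposed only for x > 0 because the potential jumps at 0;
  continuity up to 0 makes f 0 and f' 0 usable as initial data.\<close>

definition halfline_sol :: "(real \<Rightarrow> real) \<Rightarrow> (real \<Rightarrow> real) \<Rightarrow> (real \<Rightarrow> real) \<Rightarrow> bool" where
  "halfline_sol q f f' \<longleftrightarrow> continuous_on {0..} f \<and> continuous_on {0..} f' \<and>
     (\<forall>x>0. (f has_real_derivative f' x) (at x) \<and> (f' has_real_derivative q x * f x) (at x))"

lemma not_L2_if_bounded_below:
  fixes f :: "real \<Rightarrow> real"
  assumes "set_integrable lborel {0..} f" "x1 \<ge> 0" "c > 0" "\<And>x. x \<ge> x1 \<Longrightarrow> f x \<ge> c"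
  shows False
proof -
  have "set_integrable lborel {x1..} f"
    by (rule set_integrable_subset[OF assms(1)]) (use assms(2) in auto)
  then have "set_integrable lborel {x1..} (\<lambda>_. c)"
  proof (rule set_integrable_bound)
    show "AE x in lborel. x \<in> {x1..} \<longrightarrow> norm c \<le> norm (f x)"
      using assms(3,4) by (auto intro!: order_trans[OF _ abs_ge_self])
  qed (auto simp: set_borel_measurable_def)
  then have "integrable lborel (indicat_real {x1..})"
    using assms(3) by (simp add: set_integrable_def)
  then have "emeasure lborel {x1..} < \<infinity>"
    by (simp add: integrable_indicator_iff)
  then obtain m where m: "m \<ge> 0" "emeasure lborel {x1..} = ennreal m"
    by (cases "emeasure lborel {x1..}") auto
  moreover have "emeasure lborel {x1..x1 + (m + 1)} \<le> emeasure lborel {x1..}"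
    by (intro emeasure_mono) auto
  ultimately show False by simp
qed

text \<open>Where \<open>q \<ge> 0\<close>, the derivative of \<open>f\<^sup>2\<close> is nondecreasing; it vanishes at \<open>X\<close>, so \<open>f\<^sup>2\<close> cannot
  decrease afterwards.\<close>

lemma halfline_sol_L2_vanish:
  assumes sol: "halfline_sol q f f'" and L2: "set_integrable lborel {0..} (\<lambda>x. (f x)^2)"
    and X: "X > 0" "\<And>x. x \<ge> X \<Longrightarrow> q x \<ge> 0" "f X = 0" and x: "x \<ge> X"
  shows "f x = 0"
proof (rule ccontr)
  assume "f x \<noteq> 0"
  have d: "(f has_real_derivative f' x) (at x)" "(f' has_real_derivative q x * f x) (at x)" if "x \<ge> X" for x
    using sol X(1) that by (auto simp: halfline_sol_def)
  have nn: "f x * f' x \<ge> 0" if "x \<ge> X" for x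
  proof -
    have "f X * f' X \<le> f x * f' x"
    proof (rule DERIV_nonneg_imp_nondecreasing[OF that])
      fix t assume "X \<le> t" "t \<le> x"
      then show "\<exists>y. ((\<lambda>x. f x * f' x) has_real_derivative y) (at t) \<and> 0 \<le> y"
        using X(2)[of t]
        by (intro exI[of _ "f' t * f' t + q t * f t * f t"])
           (auto intro!: derivative_eq_intros d simp: mult.assoc)
    qed
    then show ?thesis using X(3) by simp
  qed
  have mono: "(f a)^2 \<le> (f c)^2" if "X \<le> a" "a \<le> c" for a c
  proof (rule DERIV_nonneg_imp_nondecreasing[OF that(2)])
    fix t assume "a \<le> t" "t \<le> c"
    then have t: "X \<le> t" using that by simp
    have "((\<lambda>x. (f x)^2) has_real_derivative 2 * (f t * f' t)) (at t)"
      by (rule derivative_eq_intros d t refl)+ (simp add: mult.commute)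
    then show "\<exists>y. ((\<lambda>x. (f x)^2) has_real_derivative y) (at t) \<and> 0 \<le> y"
      using nn[OF t] by auto
  qed
  show False
    using not_L2_if_bounded_below[OF L2, of x "(f x)^2"] mono x X(1) \<open>f x \<noteq> 0\<close> by auto
qed

lemma halfline_sol_lincomb:
  assumes "halfline_sol q f f'" "halfline_sol q g g'"
  shows "halfline_sol q (\<lambda>x. a * f x - c * g x) (\<lambda>x. a * f' x - c * g' x)"
  using assms unfolding halfline_sol_def
  by (auto intro!: continuous_intros derivative_eq_intros simp: algebra_simps)

text \<open>The combination of f and g that vanishes at X vanishes from X on by
  \<open>halfline_sol_L2_vanish\<close>, so the Wronskian is zero at X + 1. Being constant, it is
  also zero at 0.\<close>

lemma halfline_wronskian:
  assumes f: "halfline_sol q f f'" "set_integrable lborel {0..} (\<lambda>x. (f x)^2)"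
    and g: "halfline_sol q g g'" "set_integrable lborel {0..} (\<lambda>x. (g x)^2)"
    and X: "X > 0" "\<And>x. x \<ge> X \<Longrightarrow> q x \<ge> 0"
  shows "f 0 * g' 0 = f' 0 * g 0"
proof -
  define W where "W = (\<lambda>x. f x * g' x - f' x * g x)"
  define h where "h = (\<lambda>x. g X * f x - f X * g x)"
  have h_sol: "halfline_sol q h (\<lambda>x. g X * f' x - f X * g' x)"
    unfolding h_def by (rule halfline_sol_lincomb[OF f(1) g(1)])
  \<comment> \<open>The point X + 1 has a full neighbourhood on which u is zero, so local constancy
    gives u' = 0 there.\<close>
  have vanish: "u (X + 1) = 0 \<and> u' (X + 1) = 0"
    if u: "halfline_sol q u u'" "set_integrable lborel {0..} (\<lambda>x. (u x)^2)" "u X = 0" for u u'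
  proof -
    have z: "u x = 0" if "x \<ge> X" for x
      using halfline_sol_L2_vanish[OF u(1,2) X u(3) that] .
    have "(u has_real_derivative u' (X + 1)) (at (X + 1))"
      using u(1) X(1) by (auto simp: halfline_sol_def)
    then have "u' (X + 1) = 0"
      by (rule DERIV_local_const[of _ _ _ 1]) (auto simp: z)
    then show ?thesis using z by simp
  qed
  have "W (X + 1) = 0"
  proof (cases "f X = 0")
    case True
    then show ?thesis using vanish[OF f] by (simp add: W_def)
  next
    case False
    have "set_integrable lborel {0..} (\<lambda>x. (h x)^2)"
    proof (rule set_integrable_bound)
      show "set_integrable lborel {0..} (\<lambda>x. 2 * (g X)^2 * (f x)^2 + 2 * (f X)^2 * (g x)^2)"
        using f(2) g(2) by (intro set_integral_add set_integrable_mult_right)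
      have "continuous_on {0..} h" using h_sol by (simp add: halfline_sol_def)
      then have "set_borel_measurable borel {0..} (\<lambda>x. (h x)^2)"
        by (intro set_measurable_continuous_on continuous_on_power) auto
      then show "set_borel_measurable lborel {0..} (\<lambda>x. (h x)^2)"
        unfolding set_borel_measurable_def by simp
      have "(h x)^2 \<le> 2 * (g X)^2 * (f x)^2 + 2 * (f X)^2 * (g x)^2" for x
        using zero_le_power2[of "g X * f x + f X * g x"]
        by (simp add: h_def power2_eq_square algebra_simps)
      then show "AE x in lborel. x \<in> {0..} \<longrightarrow> norm ((h x)^2) \<le> norm (2 * (g X)^2 * (f x)^2 + 2 * (f X)^2 * (g x)^2)"
        by (auto intro!: order_trans[OF _ abs_ge_self])
    qed
    from vanish[OF h_sol this]
    have *: "g X * f (X + 1) = f X * g (X + 1)" "g X * f' (X + 1) = f X * g' (X + 1)"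
      by (auto simp: h_def)
    have "f X * W (X + 1) = f (X + 1) * (f X * g' (X + 1)) - f' (X + 1) * (f X * g (X + 1))"
      by (simp add: W_def algebra_simps)
    also have "\<dots> = 0"
      unfolding *[symmetric] by (simp add: algebra_simps)
    finally have "f X * W (X + 1) = 0" .
    with False show ?thesis by simp
  qed
  moreover have "W (X + 1) = W 0"
  proof (rule DERIV_isconst_end[where f = W])
    show "continuous_on {0..X + 1} W"
      unfolding W_def using f(1) g(1)
      by (auto simp: halfline_sol_def intro!: continuous_intros intro: continuous_on_subset)
    show "(W has_real_derivative 0) (at x)" if "0 < x" "x < X + 1" for x
      unfolding W_def using f(1) g(1) that
      by (auto simp: halfline_sol_def intro!: derivative_eq_intros simp: algebra_simps)
  qed (use X in auto)
  ultimately show ?thesis by (simp add: W_def)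
qed

text \<open>A Gronwall argument for the energy f^2 + f'^2.\<close>

lemma halfline_ivp_zero:
  assumes sol: "halfline_sol q f f'" and z: "f 0 = 0" "f' 0 = 0"
    and q: "continuous_on {0..R} q" and R: "R > 0"
  shows "f R = 0"
proof -
  obtain M where "\<And>x. x \<in> {0..R} \<Longrightarrow> \<bar>q x\<bar> \<le> M"
    using compact_imp_bounded[OF compact_continuous_image[OF q compact_Icc]]
    unfolding bounded_iff ball_simps real_norm_def by blast
  then have M: "\<bar>q x\<bar> \<le> M" if "0 < x" "x < R" for x
    using that by auto
  \<comment> \<open>The energy has derivative 2 f f' (1 + q), at most 1 + M times the energy, so
    this weight makes E nonincreasing from its initial value 0.\<close>
  define E where "E = (\<lambda>x. exp (- (1 + M) * x) * ((f x)^2 + (f' x)^2))"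
  have "E R \<le> E 0"
  proof (rule DERIV_nonpos_imp_decreasing_open[where f = E])
    show "continuous_on {0..R} E"
      unfolding E_def using sol
      by (auto simp: halfline_sol_def intro!: continuous_intros intro: continuous_on_subset)
    fix x assume x: "0 < x" "x < R"
    have d: "(f has_real_derivative f' x) (at x)" "(f' has_real_derivative q x * f x) (at x)"
      using sol x by (auto simp: halfline_sol_def)
    have deriv: "(E has_real_derivative exp (- (1 + M) * x) * (2 * f x * f' x * (1 + q x) - (1 + M) * ((f x)^2 + (f' x)^2))) (at x)"
      unfolding E_def by (rule derivative_eq_intros d refl)+ (simp add: algebra_simps)
    have "2 * f x * f' x * (1 + q x) \<le> (1 + M) * ((f x)^2 + (f' x)^2)"
    proof -
      have "2 * f x * f' x * (1 + q x) \<le> \<bar>2 * f x * f' x\<bar> * \<bar>1 + q x\<bar>"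
        by (metis abs_ge_self abs_mult)
      also have "\<dots> \<le> ((f x)^2 + (f' x)^2) * (1 + M)"
        using M[OF x] sum_squares_bound[of "f x" "f' x"] sum_squares_bound[of "f x" "- f' x"]
        by (intro mult_mono) (auto simp: abs_le_iff)
      finally show ?thesis by (simp add: mult.commute)
    qed
    then have "exp (- (1 + M) * x) * (2 * f x * f' x * (1 + q x) - (1 + M) * ((f x)^2 + (f' x)^2)) \<le> 0"
      by (intro mult_nonneg_nonpos) simp_all
    from conjI[OF deriv this] show "\<exists>y. (E has_real_derivative y) (at x) \<and> y \<le> 0"
      by (rule exI)
  qed (use R in auto)
  then have "(f R)^2 + (f' R)^2 \<le> 0"
    by (simp add: E_def z mult_le_0_iff)
  then show ?thesis
    by (simp add: sum_power2_le_zero_iff)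
qed

text \<open>The affine argument serves both sides: slope sqrt \<eta> and offset \<beta> / sqrt
  \<eta> on the right; offset -\<beta> on the left, with slope 1 after reflection and -1 without
  it.\<close>

lemma cyl_D_halfline_sol:
  assumes "\<nu> < 2"
  shows "halfline_sol (\<lambda>x. q^2 * ((p + q * x)^2 / 4 - 1 / 2 - \<nu>)) (\<lambda>x. cyl_D \<nu> (p + q * x)) (\<lambda>x. q * cyl_D' \<nu> (p + q * x))"
    and "((\<lambda>x. cyl_D \<nu> (p + q * x)) has_real_derivative q * cyl_D' \<nu> (p + q * x)) (at x)"
    and "((\<lambda>x. q * cyl_D' \<nu> (p + q * x)) has_real_derivative
           q^2 * ((p + q * x)^2 / 4 - 1 / 2 - \<nu>) * cyl_D \<nu> (p + q * x)) (at x)"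
proof -
  have aff: "((\<lambda>x. p + q * x) has_real_derivative q) (at x)" for x
    by (auto intro!: derivative_eq_intros)
  show 1: "((\<lambda>x. cyl_D \<nu> (p + q * x)) has_real_derivative q * cyl_D' \<nu> (p + q * x)) (at x)" for x
    by (rule DERIV_cong[OF DERIV_chain'[OF aff cyl_D_deriv[OF assms]]]) (rule mult.commute)
  have "((\<lambda>x. cyl_D' \<nu> (p + q * x)) has_real_derivative
      ((p + q * x)^2 / 4 - 1 / 2 - \<nu>) * cyl_D \<nu> (p + q * x) * q) (at x)" for x
    by (rule DERIV_chain'[OF aff cyl_D'_deriv[OF assms]])
  from DERIV_cmult[OF this, of q]
  show 2: "((\<lambda>x. q * cyl_D' \<nu> (p + q * x)) has_real_derivative
      q^2 * ((p + q * x)^2 / 4 - 1 / 2 - \<nu>) * cyl_D \<nu> (p + q * x)) (at x)" for x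
    by (rule DERIV_cong) (simp add: power2_eq_square)
  show "halfline_sol (\<lambda>x. q^2 * ((p + q * x)^2 / 4 - 1 / 2 - \<nu>)) (\<lambda>x. cyl_D \<nu> (p + q * x)) (\<lambda>x. q * cyl_D' \<nu> (p + q * x))"
    unfolding halfline_sol_def
  proof (intro conjI allI impI continuous_at_imp_continuous_on ballI)
    show "isCont (\<lambda>x. cyl_D \<nu> (p + q * x)) x" for x
      by (rule DERIV_isCont[OF 1])
    show "isCont (\<lambda>x. q * cyl_D' \<nu> (p + q * x)) x" for x
      by (rule DERIV_isCont[OF 2])
  qed (rule 1 2)+
qed

subsection \<open>Square-integrable solutions\<close>

lemma L2_solution_halflines:
  assumes "L2_solution \<beta> \<eta> lam \<psi>"
  obtains \<psi>' where
    "halfline_sol (\<lambda>x. (\<beta> + \<eta> * x)^2 / 4 - \<eta> / 2 - lam) \<psi> \<psi>'"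
    "halfline_sol (\<lambda>x. (- \<beta> + x)^2 / 4 - 1 / 2 - lam) (\<lambda>x. \<psi> (- x)) (\<lambda>x. - \<psi>' (- x))"
    "set_integrable lborel {0..} (\<lambda>x. (\<psi> x)^2)" "set_integrable lborel {0..} (\<lambda>x. (\<psi> (- x))^2)"
proof -
  obtain \<psi>' \<psi>'' where int: "integrable lborel (\<lambda>x. (\<psi> x)^2)"
    and d: "\<And>x. (\<psi> has_real_derivative \<psi>' x) (at x)" and c0: "isCont \<psi>' 0"
    and d': "\<And>x. x \<noteq> 0 \<Longrightarrow> (\<psi>' has_real_derivative \<psi>'' x) (at x)"
    and eq: "\<And>x. x \<noteq> 0 \<Longrightarrow> - \<psi>'' x + potential \<beta> \<eta> x * \<psi> x = (lam + 1/2) * \<psi> x"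
    using assms unfolding L2_solution_def by blast
  have c: "isCont \<psi> x" "isCont \<psi>' x" for x
    using DERIV_isCont[OF d, of x] DERIV_isCont[OF d', of x] c0 by (simp, cases "x = 0", simp_all)
  have cm: "isCont (\<lambda>x. \<psi> (- x)) x" "isCont (\<lambda>x. - \<psi>' (- x)) x" for x
    by (rule isCont_o2[OF _ c(1)] isCont_minus[OF isCont_o2[OF _ c(2)]], simp)+
  have e: "\<psi>'' x = (potential \<beta> \<eta> x - lam - 1 / 2) * \<psi> x" if "x \<noteq> 0" for x
    using eq[OF that] by (simp add: algebra_simps)
  show ?thesis
  proof (rule that)
    show "halfline_sol (\<lambda>x. (\<beta> + \<eta> * x)^2 / 4 - \<eta> / 2 - lam) \<psi> \<psi>'"
      unfolding halfline_sol_def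
    proof (intro conjI allI impI continuous_at_imp_continuous_on ballI c d)
      fix x :: real assume x: "x > 0"
      have "((\<beta> + \<eta> * x)^2 / 4 - \<eta> / 2 - lam) * \<psi> x = \<psi>'' x"
        using x e[of x] by (simp add: potential_def field_simps)
      then show "(\<psi>' has_real_derivative ((\<beta> + \<eta> * x)^2 / 4 - \<eta> / 2 - lam) * \<psi> x) (at x)"
        using d'[of x] x by simp
    qed
    \<comment> \<open>Reflecting the left half-line lets the theory on \<open>{0..}\<close> cover
      it; the derivative changes sign.\<close>
    show "halfline_sol (\<lambda>x. (- \<beta> + x)^2 / 4 - 1 / 2 - lam) (\<lambda>x. \<psi> (- x)) (\<lambda>x. - \<psi>' (- x))"
      unfolding halfline_sol_def
    proof (intro conjI allI impI continuous_at_imp_continuous_on ballI cm)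
      fix x :: real assume x: "x > 0"
      have m: "((\<lambda>x::real. - x) has_real_derivative - 1) (at x)"
        by (auto intro!: derivative_eq_intros)
      show "((\<lambda>x. \<psi> (- x)) has_real_derivative - \<psi>' (- x)) (at x)"
        using DERIV_chain'[OF m d] by simp
      have "(- \<beta> + x)^2 = (\<beta> - x)^2"
        by (simp add: power2_eq_square algebra_simps)
      then have "((- \<beta> + x)^2 / 4 - 1 / 2 - lam) * \<psi> (- x) = \<psi>'' (- x)"
        using x e[of "- x"] by (simp add: potential_def field_simps)
      then show "((\<lambda>x. - \<psi>' (- x)) has_real_derivative ((- \<beta> + x)^2 / 4 - 1 / 2 - lam) * \<psi> (- x)) (at x)"
        using DERIV_minus[OF DERIV_chain'[OF m d'[of "- x"]]] x by simp
    qed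
    show "set_integrable lborel {0..} (\<lambda>x. (\<psi> x)^2)"
      unfolding set_integrable_def by (rule integrable_mult_indicator[OF _ int]) simp
    have "integrable lborel (\<lambda>x. (\<psi> (0 + (- 1) * x))^2)"
      by (rule lborel_integrable_real_affine[OF int]) simp
    then have "integrable lborel (\<lambda>x. (\<psi> (- x))^2)" by simp
    then show "set_integrable lborel {0..} (\<lambda>x. (\<psi> (- x))^2)"
      unfolding set_integrable_def by (intro integrable_mult_indicator) simp_all
  qed
qed

text \<open>By uniqueness on both half-lines, zero data at the origin would make \<psi> vanish
  everywhere.\<close>

lemma L2_solution_initial_data:
  assumes "halfline_sol (\<lambda>x. (\<beta> + \<eta> * x)^2 / 4 - \<eta> / 2 - lam) \<psi> \<psi>'"
    and "halfline_sol (\<lambda>x. (- \<beta> + x)^2 / 4 - 1 / 2 - lam) (\<lambda>x. \<psi> (- x)) (\<lambda>x. - \<psi>' (- x))"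
    and "\<psi> x \<noteq> 0"
  shows "\<psi> 0 \<noteq> 0 \<or> \<psi>' 0 \<noteq> 0"
proof (rule ccontr)
  assume "\<not> ?thesis"
  then have z: "\<psi> 0 = 0" "\<psi>' 0 = 0" by auto
  have "\<psi> R = 0" if "R > 0" for R
    by (rule halfline_ivp_zero[OF assms(1) z _ that]) (rule continuous_intros | simp)+
  moreover have "\<psi> (- R) = 0" if "R > 0" for R
    by (rule halfline_ivp_zero[OF assms(2) _ _ _ that]) (auto simp: z intro!: continuous_intros)
  from this[of "- x"] have "\<psi> x = 0" if "x < 0" using that by simp
  ultimately show False
    using assms(3) z by (cases x "0 :: real" rule: linorder_cases) auto
qed

lemma cyl_right_coeff:
  assumes "\<eta> > 0"
  shows "(sqrt \<eta>)^2 * ((\<beta> / sqrt \<eta> + sqrt \<eta> * x)^2 / 4 - 1 / 2 - lam / \<eta>)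
    = (\<beta> + \<eta> * x)^2 / 4 - \<eta> / 2 - lam"
proof -
  have "(sqrt \<eta> * (\<beta> / sqrt \<eta> + sqrt \<eta> * x))^2 = (\<beta> + \<eta> * x)^2"
    using assms by (simp add: distrib_left flip: mult.assoc)
  then have "\<eta> * (\<beta> / sqrt \<eta> + sqrt \<eta> * x)^2 = (\<beta> + \<eta> * x)^2"
    using assms by (simp add: power_mult_distrib)
  then show ?thesis
    using assms by (simp add: right_diff_distrib)
qed

text \<open>The Wronskian at \<open>0\<close> of the two decaying solutions (up to sign).\<close>

definition matching :: "real \<Rightarrow> real \<Rightarrow> real \<Rightarrow> real" where
  "matching \<beta> \<eta> lam =
     sqrt \<eta> * cyl_D' (lam / \<eta>) (\<beta> / sqrt \<eta>) * cyl_D lam (- \<beta>)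
       + cyl_D (lam / \<eta>) (\<beta> / sqrt \<eta>) * cyl_D' lam (- \<beta>)"

lemma right_sol:
  assumes "\<eta> > 0" "lam < 2 * \<eta>"
  shows "halfline_sol (\<lambda>x. (\<beta> + \<eta> * x)^2 / 4 - \<eta> / 2 - lam)
      (\<lambda>x. cyl_D (lam / \<eta>) (\<beta> / sqrt \<eta> + sqrt \<eta> * x))
      (\<lambda>x. sqrt \<eta> * cyl_D' (lam / \<eta>) (\<beta> / sqrt \<eta> + sqrt \<eta> * x))"
    and "set_integrable lborel {0..} (\<lambda>x. (cyl_D (lam / \<eta>) (\<beta> / sqrt \<eta> + sqrt \<eta> * x))^2)"
proof -
  have \<nu>: "lam / \<eta> < 2" using assms by (simp add: divide_less_eq)
  show "halfline_sol (\<lambda>x. (\<beta> + \<eta> * x)^2 / 4 - \<eta> / 2 - lam)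
      (\<lambda>x. cyl_D (lam / \<eta>) (\<beta> / sqrt \<eta> + sqrt \<eta> * x))
      (\<lambda>x. sqrt \<eta> * cyl_D' (lam / \<eta>) (\<beta> / sqrt \<eta> + sqrt \<eta> * x))"
    using cyl_D_halfline_sol(1)[OF \<nu>, of "sqrt \<eta>" "\<beta> / sqrt \<eta>"]
    unfolding cyl_right_coeff[OF assms(1)] .
  show "set_integrable lborel {0..} (\<lambda>x. (cyl_D (lam / \<eta>) (\<beta> / sqrt \<eta> + sqrt \<eta> * x))^2)"
    using assms by (intro cyl_D_affine_L2 \<nu>) auto
qed

lemma left_sol:
  assumes "lam < 2"
  shows "halfline_sol (\<lambda>x. (- \<beta> + x)^2 / 4 - 1 / 2 - lam)
      (\<lambda>x. cyl_D lam (- \<beta> + x)) (\<lambda>x. cyl_D' lam (- \<beta> + x))"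
    and "set_integrable lborel {0..} (\<lambda>x. (cyl_D lam (- \<beta> + x))^2)"
  using cyl_D_halfline_sol(1)[OF assms, of 1 "- \<beta>"] cyl_D_affine_L2[OF assms, of 1 "- \<beta>"]
  by simp_all

text \<open>The two Wronskian identities are homogeneous linear equations for \<psi> 0 and \<psi>' 0
  whose determinant is \<open>matching\<close>; nonzero data force it to vanish.\<close>

lemma L2_solution_imp_matching:
  assumes \<eta>: "\<eta> > 0" and lam: "lam < 2 * \<eta>" "lam < 2"
    and sol: "L2_solution \<beta> \<eta> lam \<psi>" "\<psi> x \<noteq> 0"
  shows "matching \<beta> \<eta> lam = 0"
proof -
  obtain \<psi>' where h: "halfline_sol (\<lambda>x. (\<beta> + \<eta> * x)^2 / 4 - \<eta> / 2 - lam) \<psi> \<psi>'"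
    "halfline_sol (\<lambda>x. (- \<beta> + x)^2 / 4 - 1 / 2 - lam) (\<lambda>x. \<psi> (- x)) (\<lambda>x. - \<psi>' (- x))"
    and i: "set_integrable lborel {0..} (\<lambda>x. (\<psi> x)^2)" "set_integrable lborel {0..} (\<lambda>x. (\<psi> (- x))^2)"
    by (rule L2_solution_halflines[OF sol(1)])
  have "eventually (\<lambda>x. (\<beta> + \<eta> * x)^2 / 4 - \<eta> / 2 - lam \<ge> 0 \<and> (- \<beta> + x)^2 / 4 - 1 / 2 - lam \<ge> 0) at_top"
  proof (intro eventually_conj)
    show "\<forall>\<^sub>F x in at_top. (\<beta> + \<eta> * x)^2 / 4 - \<eta> / 2 - lam \<ge> 0"
      using \<eta> by real_asymp
    show "\<forall>\<^sub>F x in at_top. (- \<beta> + x)^2 / 4 - 1 / 2 - lam \<ge> 0"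
      by real_asymp
  qed
  then obtain X0 where X0: "\<And>x. x \<ge> X0 \<Longrightarrow> (\<beta> + \<eta> * x)^2 / 4 - \<eta> / 2 - lam \<ge> 0 \<and> (- \<beta> + x)^2 / 4 - 1 / 2 - lam \<ge> 0"
    unfolding eventually_at_top_linorder by blast
  define X where "X = max 1 X0"
  have X: "X > 0" "\<And>x. x \<ge> X \<Longrightarrow> (\<beta> + \<eta> * x)^2 / 4 - \<eta> / 2 - lam \<ge> 0"
    "\<And>x. x \<ge> X \<Longrightarrow> (- \<beta> + x)^2 / 4 - 1 / 2 - lam \<ge> 0"
    using X0 by (auto simp: X_def)
  have 1: "\<psi> 0 * (sqrt \<eta> * cyl_D' (lam / \<eta>) (\<beta> / sqrt \<eta>)) = \<psi>' 0 * cyl_D (lam / \<eta>) (\<beta> / sqrt \<eta>)"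
    using halfline_wronskian[OF h(1) i(1) right_sol[OF \<eta> lam(1)] X(1,2)] by simp
  have 2: "\<psi> 0 * cyl_D' lam (- \<beta>) = - \<psi>' 0 * cyl_D lam (- \<beta>)"
    using halfline_wronskian[OF h(2) i(2) left_sol[OF lam(2)] X(1,3)] by simp
  have "\<psi> 0 * matching \<beta> \<eta> lam = 0"
  proof -
    have "\<psi> 0 * matching \<beta> \<eta> lam = \<psi> 0 * (sqrt \<eta> * cyl_D' (lam / \<eta>) (\<beta> / sqrt \<eta>)) * cyl_D lam (- \<beta>)
        + cyl_D (lam / \<eta>) (\<beta> / sqrt \<eta>) * (\<psi> 0 * cyl_D' lam (- \<beta>))"
      by (simp add: matching_def algebra_simps)
    then show ?thesis unfolding 1 2 by simp
  qed
  moreover have "\<psi>' 0 * matching \<beta> \<eta> lam = 0"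
  proof -
    have "\<psi>' 0 * matching \<beta> \<eta> lam = - (sqrt \<eta> * cyl_D' (lam / \<eta>) (\<beta> / sqrt \<eta>)) * (- \<psi>' 0 * cyl_D lam (- \<beta>))
        + (\<psi>' 0 * cyl_D (lam / \<eta>) (\<beta> / sqrt \<eta>)) * cyl_D' lam (- \<beta>)"
      by (simp add: matching_def algebra_simps)
    then show ?thesis unfolding 1[symmetric] 2[symmetric] by simp
  qed
  ultimately show ?thesis
    using L2_solution_initial_data[OF h sol(2)] by auto
qed

section \<open>From the matching condition back to a solution\<close>

lemma has_real_derivative_glue:
  fixes g h :: "real \<Rightarrow> real"
  assumes "\<And>x. (g has_real_derivative g' x) (at x)" "\<And>x. (h has_real_derivative h' x) (at x)"
    and "g 0 = h 0" "x = 0 \<Longrightarrow> g' 0 = h' 0"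
  shows "((\<lambda>x. if x \<ge> 0 then g x else h x) has_real_derivative (if x \<ge> 0 then g' x else h' x)) (at x)"
proof (cases x "0::real" rule: linorder_cases)
  case less
  then have "((\<lambda>x. if x \<ge> 0 then g x else h x) has_real_derivative h' x) (at x)"
    by (intro has_field_derivative_transform_within_open[OF assms(2), where S = "{..<0}"]) auto
  then show ?thesis using less by simp
next
  case greater
  then have "((\<lambda>x. if x \<ge> 0 then g x else h x) has_real_derivative g' x) (at x)"
    by (intro has_field_derivative_transform_within_open[OF assms(1), where S = "{0<..}"]) auto
  then show ?thesis using greater by simp
next
  case equal
  let ?f = "\<lambda>x. if x \<ge> 0 then g x else h x"
  have "((\<lambda>y. (?f y - ?f 0) / (y - 0)) \<longlongrightarrow> g' 0) (at 0)"
  proof (rule filterlim_split_at)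
    have "((\<lambda>y. (h y - h 0) / (y - 0)) \<longlongrightarrow> g' 0) (at_left 0)"
      using has_field_derivative_at_within[OF assms(2)[of 0]] assms(4)[OF equal]
      unfolding has_field_derivative_iff by auto
    then show "((\<lambda>y. (?f y - ?f 0) / (y - 0)) \<longlongrightarrow> g' 0) (at_left 0)"
      by (rule Lim_transform_eventually) (auto simp: eventually_at_filter assms(3))
    have "((\<lambda>y. (g y - g 0) / (y - 0)) \<longlongrightarrow> g' 0) (at_right 0)"
      using has_field_derivative_at_within[OF assms(1)[of 0]]
      unfolding has_field_derivative_iff by auto
    then show "((\<lambda>y. (?f y - ?f 0) / (y - 0)) \<longlongrightarrow> g' 0) (at_right 0)"
      by (rule Lim_transform_eventually) (auto simp: eventually_at_filter)
  qed
  then show ?thesis using equal by (simp add: has_field_derivative_iff)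
qed

text \<open>Each decaying solution is scaled by the other's value at 0, so the values agree there
  automatically and the slopes agree precisely when \<open>matching\<close> vanishes. That \<psi> is
  not identically zero is settled in \<open>eigenvalue_iff\<close>.\<close>

lemma matching_imp_L2_solution:
  assumes \<eta>: "\<eta> > 0" and lam: "lam < 2 * \<eta>" "lam < 2" and m: "matching \<beta> \<eta> lam = 0"
  defines "\<psi> \<equiv> \<lambda>x. if x \<ge> 0 then cyl_D lam (- \<beta>) * cyl_D (lam / \<eta>) (\<beta> / sqrt \<eta> + sqrt \<eta> * x)
      else cyl_D (lam / \<eta>) (\<beta> / sqrt \<eta>) * cyl_D lam (- \<beta> - x)"
  shows "L2_solution \<beta> \<eta> lam \<psi>"
proof -
  have \<nu>: "lam / \<eta> < 2" using \<eta> lam by (simp add: divide_less_eq)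
  define DL DR where "DL = cyl_D lam (- \<beta>)" and "DR = cyl_D (lam / \<eta>) (\<beta> / sqrt \<eta>)"
  define g g1 g2 where "g = (\<lambda>x. DL * cyl_D (lam / \<eta>) (\<beta> / sqrt \<eta> + sqrt \<eta> * x))"
    and "g1 = (\<lambda>x. DL * (sqrt \<eta> * cyl_D' (lam / \<eta>) (\<beta> / sqrt \<eta> + sqrt \<eta> * x)))"
    and "g2 = (\<lambda>x. ((\<beta> + \<eta> * x)^2 / 4 - \<eta> / 2 - lam) * g x)"
  define h h1 h2 where "h = (\<lambda>x. DR * cyl_D lam (- \<beta> + (- 1) * x))"
    and "h1 = (\<lambda>x. DR * ((- 1) * cyl_D' lam (- \<beta> + (- 1) * x)))"
    and "h2 = (\<lambda>x. ((\<beta> + x)^2 / 4 - 1 / 2 - lam) * h x)"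
  have \<psi>: "\<psi> = (\<lambda>x. if x \<ge> 0 then g x else h x)"
    by (auto simp: \<psi>_def g_def h_def DL_def DR_def fun_eq_iff)
  have gd: "(g has_real_derivative g1 x) (at x)" for x
    unfolding g_def g1_def by (intro DERIV_cmult cyl_D_halfline_sol(2) \<nu>)
  have gd1: "(g1 has_real_derivative g2 x) (at x)" for x
    unfolding g1_def g2_def g_def
    using DERIV_cmult[OF cyl_D_halfline_sol(3)[OF \<nu>, of "sqrt \<eta>" "\<beta> / sqrt \<eta>" x], of DL]
    unfolding cyl_right_coeff[OF \<eta>] by (simp only: mult.left_commute)
  have hd: "(h has_real_derivative h1 x) (at x)" for x
    unfolding h_def h1_def by (intro DERIV_cmult cyl_D_halfline_sol(2) lam)
  have hd1: "(h1 has_real_derivative h2 x) (at x)" for x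
  proof -
    have "(- 1)^2 * ((- \<beta> + (- 1) * x)^2 / 4 - 1 / 2 - lam) = (\<beta> + x)^2 / 4 - 1 / 2 - lam"
      by (simp add: power2_eq_square field_simps)
    with DERIV_cmult[OF cyl_D_halfline_sol(3)[OF lam(2), of "- 1" "- \<beta>" x], of DR]
    show ?thesis
      unfolding h1_def h2_def h_def by (simp only: mult.left_commute)
  qed
  have 0: "g 0 = h 0" by (simp add: g_def h_def DL_def DR_def)
  have 1: "g1 0 = h1 0"
    using m by (simp add: g1_def h1_def matching_def DL_def DR_def algebra_simps)
  let ?\<psi>1 = "\<lambda>x. if x \<ge> 0 then g1 x else h1 x"
  let ?\<psi>2 = "\<lambda>x. if x \<ge> 0 then g2 x else h2 x"
  have d: "(\<psi> has_real_derivative ?\<psi>1 x) (at x)" for x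
    unfolding \<psi> by (intro has_real_derivative_glue gd hd 0 1)
  have d1: "(?\<psi>1 has_real_derivative ?\<psi>2 x) (at x)" if "x \<noteq> 0" for x
    by (intro has_real_derivative_glue gd1 hd1 1) (use that in simp)
  have c1: "isCont ?\<psi>1 0"
  proof -
    have "continuous_on ({0..} \<union> {..0}) (\<lambda>x. if x \<in> {0..} then g1 x else h1 x)"
      by (intro continuous_on_If continuous_at_imp_continuous_on ballI DERIV_isCont[OF gd1] DERIV_isCont[OF hd1])
         (auto simp: 1)
    moreover have "{0..} \<union> {..0} = (UNIV :: real set)" by auto
    ultimately show ?thesis by (simp add: continuous_on_eq_continuous_at)
  qed
  have "integrable lborel (\<lambda>x. (\<psi> x)^2)"
  proof -
    have I1: "integrable lborel (\<lambda>x. indicator {0..} x *\<^sub>R (g x)^2)"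
      using right_sol(2)[OF \<eta> lam(1), of \<beta>]
      unfolding g_def power_mult_distrib set_integrable_def[symmetric] by simp
    have "integrable lborel (\<lambda>x. indicator {0..} x *\<^sub>R (DR * cyl_D lam (- \<beta> + x))^2)"
      using left_sol(2)[OF lam(2), of \<beta>]
      unfolding power_mult_distrib set_integrable_def[symmetric] by simp
    from lborel_integrable_real_affine[OF this, of "- 1" 0]
    have I2: "integrable lborel (\<lambda>x. indicator {0..} (- x) *\<^sub>R (h x)^2)"
      by (simp add: h_def)
    have "integrable lborel (\<lambda>x. indicator {..<0} x *\<^sub>R (indicator {0..} (- x) *\<^sub>R (h x)^2))"
      by (rule integrable_mult_indicator[OF _ I2]) simp
    note Bochner_Integration.integrable_add[OF I1 this]
    also have "(\<lambda>x. indicator {0..} x *\<^sub>R (g x)^2 + indicator {..<0} x *\<^sub>R (indicator {0..} (- x) *\<^sub>R (h x)^2))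
        = (\<lambda>x. (\<psi> x)^2)"
      unfolding \<psi> by (rule ext) (simp split: split_indicator)
    finally show ?thesis .
  qed
  moreover have eq: "- ?\<psi>2 x + potential \<beta> \<eta> x * \<psi> x = (lam + 1 / 2) * \<psi> x" if "x \<noteq> 0" for x
    using that by (auto simp: \<psi> g2_def h2_def potential_def field_simps)
  ultimately show ?thesis
    unfolding L2_solution_def
    by (intro conjI exI[of _ ?\<psi>1] exI[of _ ?\<psi>2] allI impI d c1 d1)
qed

subsection \<open>The characteristic equation\<close>

text \<open>\<open>lam = \<eta> * (1 + \<mu>)\<close> is an eigenvalue iff \<open>char_fun \<beta> \<eta> \<mu> = 0\<close>; it is \<open>matching\<close>
  with positive factors removed.\<close>

definition char_fun :: "real \<Rightarrow> real \<Rightarrow> real \<Rightarrow> real" where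
  "char_fun \<beta> \<eta> \<mu> =
     cyl_A (1 - \<mu>) (\<beta> / sqrt \<eta>) * cyl_int (2 - \<eta> * (1 + \<mu>)) (- \<beta>)
       - sqrt \<eta> * \<mu> * cyl_int (1 - \<mu>) (\<beta> / sqrt \<eta>) * cyl_int (1 - \<eta> * (1 + \<mu>)) (- \<beta>)"

lemma matching_eq:
  assumes \<eta>: "\<eta> > 0" and lam: "\<eta> * (1 + \<mu>) < 1"
  shows "matching \<beta> \<eta> (\<eta> * (1 + \<mu>)) =
    exp (- ((\<beta> / sqrt \<eta>)^2 / 4)) * exp (- (\<beta>^2 / 4)) * sqrt \<eta> * (1 + \<mu>) * (1 - \<eta> * (1 + \<mu>)) * char_fun \<beta> \<eta> \<mu>"
proof -
  define s where "s = sqrt \<eta>"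
  define y where "y = \<beta> / s"
  define \<nu> where "\<nu> = 1 + \<mu>"
  define l where "l = \<eta> * \<nu>"
  define A K where "A = cyl_A (1 - \<mu>) y" and "K = cyl_int (1 - \<mu>) y"
  define A' K1 K2 where "A' = cyl_A (2 - l) (- \<beta>)" and "K1 = cyl_int (1 - l) (- \<beta>)" and "K2 = cyl_int (2 - l) (- \<beta>)"
  have s: "s * s = \<eta>" "s * y = \<beta>" using \<eta> by (auto simp: s_def y_def)
  have l: "l < 1" using lam by (simp add: l_def \<nu>_def)
  have \<nu>2: "2 - \<nu> = 1 - \<mu>" "\<nu> - 1 = \<mu>" by (auto simp: \<nu>_def)
  have A': "A' = (1 - l) * K1"
    using cyl_A_eq[of "2 - l" "- \<beta>"] l by (simp add: A'_def K1_def)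
  \<comment> \<open>The terms from differentiating the Gaussians cancel, and so do those with
    \<open>A * K1\<close>, in both cases because s y = \<beta>.\<close>
  have "s * (\<nu> * A - y / 2 * (y * A - \<mu> * K)) * (- \<beta> * A' - (l - 1) * K2)
      + (y * A - \<mu> * K) * (l * A' - (- \<beta> / 2) * (- \<beta> * A' - (l - 1) * K2))
      = s * \<nu> * (1 - l) * (A * K2 - s * \<mu> * K * K1)"
    unfolding A' l_def s(1)[symmetric] s(2)[symmetric] by (simp add: field_simps)
  moreover have "matching \<beta> \<eta> l = exp (- (y^2 / 4)) * exp (- (\<beta>^2 / 4)) *
      (s * (\<nu> * A - y / 2 * (y * A - \<mu> * K)) * (- \<beta> * A' - (l - 1) * K2)
      + (y * A - \<mu> * K) * (l * A' - (- \<beta> / 2) * (- \<beta> * A' - (l - 1) * K2)))"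
  proof -
    have "l / \<eta> = \<nu>" using \<eta> by (simp add: l_def)
    then show ?thesis
      unfolding matching_def cyl_D_def cyl_D'_def cyl_U_def s_def[symmetric]
      unfolding y_def[symmetric]
      by (simp only: \<nu>2 A_def[symmetric] K_def[symmetric] A'_def[symmetric] K2_def[symmetric] power2_minus)
         (simp add: distrib_left distrib_right ac_simps)
  qed
  moreover have "char_fun \<beta> \<eta> \<mu> = A * K2 - s * \<mu> * K * K1"
    by (simp add: char_fun_def A_def K_def K1_def K2_def l_def \<nu>_def s_def y_def)
  ultimately show ?thesis
    by (simp add: l_def \<nu>_def s_def y_def mult.assoc)
qed

lemma eigenvalue_iff:
  assumes \<beta>: "\<beta> \<le> 0" and \<eta>: "\<eta> > 0" and \<mu>: "-1 < \<mu>" "\<mu> < 1" "\<mu> \<noteq> 0" and lam: "\<eta> * (1 + \<mu>) < 1"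
  shows "(\<exists>\<psi>. L2_solution \<beta> \<eta> (\<eta> * (1 + \<mu>)) \<psi> \<and> (\<exists>x. \<psi> x \<noteq> 0)) \<longleftrightarrow> char_fun \<beta> \<eta> \<mu> = 0"
proof -
  have lam2: "\<eta> * (1 + \<mu>) < 2 * \<eta>" "\<eta> * (1 + \<mu>) < 2" using \<eta> \<mu> lam by auto
  have m: "matching \<beta> \<eta> (\<eta> * (1 + \<mu>)) = 0 \<longleftrightarrow> char_fun \<beta> \<eta> \<mu> = 0"
    unfolding matching_eq[OF \<eta> lam] using \<eta> \<mu> lam by auto
  show ?thesis
  proof
    assume "\<exists>\<psi>. L2_solution \<beta> \<eta> (\<eta> * (1 + \<mu>)) \<psi> \<and> (\<exists>x. \<psi> x \<noteq> 0)"
    then show "char_fun \<beta> \<eta> \<mu> = 0"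
      using L2_solution_imp_matching[OF \<eta> lam2] m by blast
  next
    assume "char_fun \<beta> \<eta> \<mu> = 0"
    then have "matching \<beta> \<eta> (\<eta> * (1 + \<mu>)) = 0" using m by simp
    note sol = matching_imp_L2_solution[OF \<eta> lam2 this]
    \<comment> \<open>Nontriviality is checked at x = -\<beta> / \<eta>, where the right-hand
      argument is 0 and \<open>cyl_U (1 + \<mu>) 0\<close> is -\<mu> times a positive integral. The
      left factor is nonzero since for \<beta> <= 0 its two terms cannot cancel.\<close>
    have "cyl_A (2 - \<eta> * (1 + \<mu>)) (- \<beta>) > 0"
      using cyl_A_eq[of "2 - \<eta> * (1 + \<mu>)" "- \<beta>"] cyl_pos[of "1 - \<eta> * (1 + \<mu>)" "- \<beta>"] lam by simp
    then have "- \<beta> * cyl_A (2 - \<eta> * (1 + \<mu>)) (- \<beta>) \<ge> 0"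
      using \<beta> by (intro mult_nonneg_nonneg) auto
    moreover have "(\<eta> * (1 + \<mu>) - 1) * cyl_int (2 - \<eta> * (1 + \<mu>)) (- \<beta>) < 0"
      using lam by (intro mult_neg_pos cyl_pos) auto
    ultimately have L: "cyl_D (\<eta> * (1 + \<mu>)) (- \<beta>) \<noteq> 0"
      unfolding cyl_D_def cyl_U_def by simp
    have R: "cyl_D (1 + \<mu>) 0 \<noteq> 0"
      using cyl_pos[of "1 - \<mu>" 0] \<mu> by (simp add: cyl_D_def cyl_U_def)
    have z: "\<beta> / sqrt \<eta> + sqrt \<eta> * (- \<beta> / \<eta>) = 0" "0 \<le> - \<beta> / \<eta>"
      using \<beta> \<eta> by (simp_all add: field_simps)
    show "\<exists>\<psi>. L2_solution \<beta> \<eta> (\<eta> * (1 + \<mu>)) \<psi> \<and> (\<exists>x. \<psi> x \<noteq> 0)"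
      by (rule exI, rule conjI[OF sol], rule exI[of _ "- \<beta> / \<eta>"])
         (use L R \<eta> in \<open>simp only: z if_True\<close>, simp)
  qed
qed

text \<open>The factor \<open>cyl_A (1 - \<mu>)\<close> is -\<mu> times a positive integral for
  \<mu> < 0 and equals 1 for \<mu> = 0, and the subtracted term is not positive. Hence roots occur
  only for \<mu> > 0.\<close>

lemma char_fun_pos:
  assumes \<eta>: "\<eta> > 0" and \<mu>: "\<mu> \<le> 0" and lam: "\<eta> * (1 + \<mu>) < 1"
  shows "char_fun \<beta> \<eta> \<mu> > 0"
proof -
  have A: "cyl_A (1 - \<mu>) y > 0" for y
  proof (cases "\<mu> = 0")
    case True
    then show ?thesis by (simp add: cyl_A_1)
  next
    case False
    then show ?thesis
      using \<mu> cyl_A_eq[of "1 - \<mu>" y] cyl_pos[of "- \<mu>" y] by (simp add: mult_neg_pos)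
  qed
  have K: "cyl_int (2 - \<eta> * (1 + \<mu>)) (- \<beta>) > 0" "cyl_int (1 - \<eta> * (1 + \<mu>)) (- \<beta>) > 0"
    "cyl_int (1 - \<mu>) (\<beta> / sqrt \<eta>) > 0"
    using lam \<mu> by (auto intro!: cyl_pos)
  have "sqrt \<eta> * \<mu> * (cyl_int (1 - \<mu>) (\<beta> / sqrt \<eta>) * cyl_int (1 - \<eta> * (1 + \<mu>)) (- \<beta>)) \<le> 0"
    using K \<eta> \<mu> by (intro mult_nonpos_nonneg mult_nonneg_nonpos) auto
  moreover have "cyl_A (1 - \<mu>) (\<beta> / sqrt \<eta>) * cyl_int (2 - \<eta> * (1 + \<mu>)) (- \<beta>) > 0"
    using A K by (intro mult_pos_pos)
  ultimately show ?thesis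
    unfolding char_fun_def by (simp add: mult.assoc)
qed

text \<open>Dividing \<open>char_fun\<close> by its two \<open>cyl_int\<close> factors leaves a product of two ratios that are
  nonincreasing in \<open>\<mu>\<close>, minus \<open>sqrt \<eta> * \<mu>\<close>.\<close>

lemma char_fun_crossing:
  assumes \<eta>: "\<eta> > 0" and m: "m1 < m2" "m2 < 1" and lam: "\<eta> * (1 + m2) < 1"
    and neg: "char_fun \<beta> \<eta> m1 \<le> 0"
  shows "char_fun \<beta> \<eta> m2 < 0"
proof -
  define y where "y = \<beta> / sqrt \<eta>"
  define k l a r where "k = (\<lambda>m. cyl_int (1 - m) y)" and "l = (\<lambda>m. cyl_int (1 - \<eta> * (1 + m)) (- \<beta>))"
    and "a = (\<lambda>m. cyl_int (1 - m + 1) y / k m + y)"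
    and "r = (\<lambda>m. cyl_int (1 - \<eta> * (1 + m) + 1) (- \<beta>) / l m)"
  have lam': "\<eta> * (1 + m1) < \<eta> * (1 + m2)" using \<eta> m by simp
  have pos: "k m1 > 0" "k m2 > 0" "l m1 > 0" "l m2 > 0" "r m1 > 0" "r m2 > 0"
    using m lam lam' by (auto simp: k_def l_def r_def intro!: cyl_pos divide_pos_pos)
  have factor: "char_fun \<beta> \<eta> m = k m * l m * (a m * r m - sqrt \<eta> * m)" if "k m > 0" "l m > 0" for m
    using that unfolding char_fun_def a_def r_def cyl_A_def
    by (simp add: k_def l_def y_def field_simps)
  have "m1 > 0"
  proof (rule ccontr)
    assume "\<not> m1 > 0"
    then have "char_fun \<beta> \<eta> m1 > 0"
      using lam lam' by (intro char_fun_pos[OF \<eta>]) linarith+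
    with neg show False by simp
  qed
  have mono: "a m2 \<le> a m1" "r m2 \<le> r m1"
    using cyl_ratio_mono[of "1 - m2" "1 - m1" y] cyl_ratio_mono[of "1 - \<eta> * (1 + m2)" "1 - \<eta> * (1 + m1)" "- \<beta>"] m lam lam'
    by (auto simp: a_def r_def k_def l_def)
  have S1: "a m1 * r m1 \<le> sqrt \<eta> * m1"
    using neg pos factor[of m1] by (simp add: mult_le_0_iff not_le[symmetric] zero_less_mult_iff)
  have "a m2 * r m2 < sqrt \<eta> * m2"
  \<comment> \<open>Monotonicity of the two factors passes to the product only while a stays
    nonnegative; if a m2 <= 0, comparing signs is enough.\<close>
  proof (cases "a m2 \<le> 0")
    case True
    then have "a m2 * r m2 \<le> 0" using pos by (simp add: mult_nonpos_nonneg)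
    also have "0 < sqrt \<eta> * m2" using \<eta> \<open>m1 > 0\<close> m by simp
    finally show ?thesis .
  next
    case False
    then have "a m2 * r m2 \<le> a m1 * r m1"
      using mono pos by (intro mult_mono) auto
    also note S1
    also have "sqrt \<eta> * m1 < sqrt \<eta> * m2" using \<eta> m by simp
    finally show ?thesis .
  qed
  then show ?thesis
    using pos factor[of m2] by (simp add: mult_pos_neg)
qed

lemma isCont_char_fun:
  assumes "m < 1" "\<eta> * (1 + m) < 1"
  shows "isCont (char_fun \<beta> \<eta>) m"
proof -
  have K: "isCont (\<lambda>m. cyl_int (f m) y) m" if "isCont f m" "f m > 0" for f y
    using isCont_o2[OF that(1) isCont_cyl_order[OF that(2)]] .
  show ?thesis
    unfolding char_fun_def[abs_def] cyl_A_def
    by (intro continuous_intros K) (use assms in auto)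
qed

text \<open>The intermediate value theorem provides a root \<mu>. A smaller positive eigenvalue
  would give an earlier root, and \<open>char_fun_crossing\<close> would then make the function
  negative at \<mu>. The condition 2 \<eta> < 1 keeps \<eta> (1 + x) below 1 for x < 1.\<close>

lemma spectral_gap_between:
  assumes \<beta>: "\<beta> \<le> 0" and \<eta>: "0 < \<eta>" "2 * \<eta> < 1" and m: "0 < m1" "m1 < m2" "m2 < 1"
    and pos: "char_fun \<beta> \<eta> m1 > 0" and neg: "char_fun \<beta> \<eta> m2 < 0"
  obtains \<mu> where "m1 < \<mu>" "\<mu> < m2" "spectral_gap \<beta> \<eta> = \<eta> * (1 + \<mu>)"
proof -
  have lam: "\<eta> * (1 + x) < 1" if "x < 1" for x
  proof -
    have "\<eta> * (1 + x) < \<eta> * 2" using that \<eta> by (intro mult_strict_left_mono) auto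
    then show ?thesis using \<eta> by linarith
  qed
  have "\<exists>x\<ge>m1. x \<le> m2 \<and> char_fun \<beta> \<eta> x = 0"
    using pos neg m lam by (intro IVT2) (auto intro!: isCont_char_fun)
  then obtain \<mu> where \<mu>: "m1 \<le> \<mu>" "\<mu> \<le> m2" "char_fun \<beta> \<eta> \<mu> = 0" by blast
  have \<mu>': "m1 < \<mu>" "\<mu> < m2" using \<mu> pos neg by (auto simp: less_le)
  have "spectral_gap \<beta> \<eta> = \<eta> * (1 + \<mu>)"
    unfolding spectral_gap_def
  proof (rule Least_equality)
    show "0 < \<eta> * (1 + \<mu>) \<and> (\<exists>\<psi>. L2_solution \<beta> \<eta> (\<eta> * (1 + \<mu>)) \<psi> \<and> (\<exists>x. \<psi> x \<noteq> 0))"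
      using eigenvalue_iff[OF \<beta>, of \<eta> \<mu>] \<mu> \<mu>' m \<eta> lam[of \<mu>] by auto
  next
    fix x assume x: "0 < x \<and> (\<exists>\<psi>. L2_solution \<beta> \<eta> x \<psi> \<and> (\<exists>t. \<psi> t \<noteq> 0))"
    show "\<eta> * (1 + \<mu>) \<le> x"
    proof (rule ccontr)
      assume "\<not> \<eta> * (1 + \<mu>) \<le> x"
      then have less: "x < \<eta> * (1 + \<mu>)" by simp
      define m where "m = x / \<eta> - 1"
      have xm: "x = \<eta> * (1 + m)" using \<eta> by (simp add: m_def)
      have m_less: "m < \<mu>" "-1 < m" "m < 1"
        using less x \<eta> \<mu>' m(3) unfolding xm by (auto simp: zero_less_mult_iff)
      have "matching \<beta> \<eta> x = 0"
      proof -
        obtain \<psi> t where "L2_solution \<beta> \<eta> x \<psi>" "\<psi> t \<noteq> 0" using x by blast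
        moreover have "x < 2 * \<eta>" "x < 2" using m_less \<eta> lam[of m] by (auto simp: xm)
        ultimately show ?thesis using L2_solution_imp_matching \<eta>(1) by blast
      qed
      then have "char_fun \<beta> \<eta> m = 0"
        using matching_eq[of \<eta> m \<beta>] \<eta> lam[of m] m_less unfolding xm by simp
      then have "char_fun \<beta> \<eta> \<mu> < 0"
        using char_fun_crossing[of \<eta> m \<mu> \<beta>] m_less \<mu>' m(3) \<eta> lam[of \<mu>] by simp
      with \<mu> show False by simp
    qed
  qed
  with \<mu>' show ?thesis by (rule that)
qed

subsection \<open>Asymptotics as \<open>\<eta> \<rightarrow> 0\<close>\<close>

lemma cyl_order_bound:
  assumes "0 \<le> \<mu>" "\<mu> \<le> 1 / 2"
  shows "\<bar>cyl_int (1 - \<mu>) y - cyl_int 1 y\<bar> \<le> 2 * \<mu> * (cyl_int (1 / 2) y + cyl_int 2 y)"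
proof -
  have pos: "cyl_int 1 y > 0" "cyl_int (1 / 2) y > 0" "cyl_int 2 y > 0"
    by (auto intro!: cyl_pos)
  \<comment> \<open>Upper bound: 1 - \<mu> lies on the segment from 1 to 1/2 with weights 1 - 2
    \<mu> and 2 \<mu>.\<close>
  have "cyl_int ((1 - 2 * \<mu>) *\<^sub>R 1 + (2 * \<mu>) *\<^sub>R (1 / 2)) y
      \<le> (1 - 2 * \<mu>) * cyl_int 1 y + (2 * \<mu>) * cyl_int (1 / 2) y"
    using assms by (intro convex_onD[OF cyl_convex]) auto
  then have up: "cyl_int (1 - \<mu>) y \<le> cyl_int 1 y - 2 * \<mu> * cyl_int 1 y + 2 * \<mu> * cyl_int (1 / 2) y"
    by (simp add: algebra_simps)
  \<comment> \<open>Lower bound: this weight exhibits 1 as a convex combination of 1 - \<mu> and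
    2.\<close>
  let ?t = "\<mu> / (1 + \<mu>)"
  have "cyl_int ((1 - ?t) *\<^sub>R (1 - \<mu>) + ?t *\<^sub>R 2) y \<le> (1 - ?t) * cyl_int (1 - \<mu>) y + ?t * cyl_int 2 y"
    using assms by (intro convex_onD[OF cyl_convex]) auto
  moreover have t: "1 - ?t = 1 / (1 + \<mu>)"
    using assms by (simp add: field_simps)
  moreover have "(1 - ?t) *\<^sub>R (1 - \<mu>) + ?t *\<^sub>R 2 = 1"
    unfolding t using assms by (simp flip: add_divide_distrib)
  ultimately have "cyl_int 1 y \<le> (cyl_int (1 - \<mu>) y + \<mu> * cyl_int 2 y) / (1 + \<mu>)"
    by (simp add: add_divide_distrib)
  then have low: "cyl_int 1 y + \<mu> * cyl_int 1 y \<le> cyl_int (1 - \<mu>) y + \<mu> * cyl_int 2 y"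
    using assms by (simp add: field_simps)
  have "0 \<le> \<mu> * cyl_int 1 y" "0 \<le> \<mu> * cyl_int 2 y" "0 \<le> \<mu> * cyl_int (1 / 2) y"
    using assms pos by auto
  with up low show ?thesis by (simp add: abs_le_iff algebra_simps)
qed

text \<open>Since \<open>cyl_int s y\<close> is convex in \<open>s\<close>, its variation near \<open>s = 1\<close> is controlled by the values at
  \<open>1 / 2\<close> and \<open>2\<close>. This crude error suffices because \<open>\<mu>\<close> will be of size \<open>z e\<^bsup>-z\<^sup>2/2\<^esup>\<close>, while \<open>cyl_bound z\<close>
  exceeds \<open>e\<^bsup>z\<^sup>2/2\<^esup>\<close> by a factor of order \<open>e\<^sup>z\<close> only.\<close>

definition cyl_bound :: "real \<Rightarrow> real" where
  "cyl_bound z = (Gamma (1 / 2) + Gamma 2) * exp ((1 + z)^2 / 2)"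

lemma cyl_order_bound':
  assumes "0 \<le> \<mu>" "\<mu> \<le> 1 / 2" "0 \<le> w" "w \<le> z"
  shows "\<bar>cyl_int (1 - \<mu>) (- w) - cyl_int 1 (- w)\<bar> \<le> 2 * \<mu> * cyl_bound z"
proof -
  have "cyl_int (1 / 2) (- w) + cyl_int 2 (- w)
      \<le> exp ((1 - - w)^2 / 2) * Gamma (1 / 2) + exp ((1 - - w)^2 / 2) * Gamma 2"
    by (intro add_mono cyl_le) auto
  also have "\<dots> = (Gamma (1 / 2) + Gamma 2) * exp ((1 + w)^2 / 2)"
    by (simp add: algebra_simps)
  also have "\<dots> \<le> cyl_bound z"
    unfolding cyl_bound_def using assms
    by (intro mult_left_mono) (auto intro!: divide_right_mono power_mono less_imp_le[OF add_pos_pos] Gamma_real_pos)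
  finally show ?thesis
    using assms by (intro order_trans[OF cyl_order_bound] mult_left_mono) auto
qed

text \<open>The coefficient of -\<mu> when \<open>cyl_A (1 - \<mu>) (- z)\<close> is expanded about
  its value at z = 0.\<close>

definition cyl_N :: "real \<Rightarrow> real" where
  "cyl_N z = integral {0..z} (\<lambda>w. cyl_int 1 (- w))"

lemma continuous_cyl1: "continuous_on S (\<lambda>w. cyl_int 1 (- w))"
proof (intro continuous_at_imp_continuous_on ballI)
  show "isCont (\<lambda>w. cyl_int 1 (- w)) x" for x
    by (rule isCont_o2[OF _ DERIV_isCont[OF cyl_deriv]]) auto
qed

lemma cyl_N_deriv_within:
  assumes "0 \<le> z" "z \<le> b"
  shows "(cyl_N has_real_derivative cyl_int 1 (- z)) (at z within {0..b})"
  unfolding cyl_N_def[abs_def]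
  using assms continuous_cyl1 by (intro integral_has_real_derivative) auto

lemma cyl_N_deriv:
  assumes "0 < z"
  shows "(cyl_N has_real_derivative cyl_int 1 (- z)) (at z)"
  using cyl_N_deriv_within[of z "z + 1"] assms
  by (simp add: at_within_interior[of z "{0..z+1}"] interior_atLeastAtMost_real)

text \<open>\<open>cyl_A\<close> is here a difference of two exponentially large terms, so
  estimating them separately would lose the cancellation. Its derivative in z carries an explicit
  factor \<mu>, and replacing order 1 - \<mu> by 1 in it costs a second \<mu>; the mean value
  theorem on [0, z] concludes.\<close>

lemma cyl_A_bound:
  assumes \<mu>: "0 \<le> \<mu>" "\<mu> \<le> 1 / 2" and z: "0 < z"
  shows "\<bar>cyl_A (1 - \<mu>) (- z) - (cyl_int (2 - \<mu>) 0 - \<mu> * cyl_N z)\<bar> \<le> 2 * \<mu>^2 * (z * cyl_bound z)"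
proof -
  define G where "G = (\<lambda>w. cyl_A (1 - \<mu>) (- w) + \<mu> * cyl_N w)"
  have dA: "((\<lambda>w. cyl_A (1 - \<mu>) (- w)) has_real_derivative - (\<mu> * cyl_int (1 - \<mu>) (- w))) (at w)" for w
  proof -
    have "((\<lambda>w::real. - w) has_real_derivative - 1) (at w)"
      by (auto intro!: derivative_eq_intros)
    from DERIV_chain'[OF this cyl_A_deriv[of "1 - \<mu>" "- w"]] show ?thesis
      using \<mu> by simp
  qed
  have d: "(G has_real_derivative - (\<mu> * cyl_int (1 - \<mu>) (- w)) + \<mu> * cyl_int 1 (- w)) (at w)" if "0 < w" for w
    unfolding G_def by (intro DERIV_add DERIV_cmult dA cyl_N_deriv that)
  have "continuous_on {0..z} G"
    unfolding G_def
    by (intro continuous_on_add continuous_on_mult continuous_on_const DERIV_continuous_on[OF cyl_N_deriv_within]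
        continuous_at_imp_continuous_on ballI DERIV_isCont[OF dA]) auto
  then obtain l w where w: "0 < w" "w < z" "(G has_real_derivative l) (at w)" "G z - G 0 = (z - 0) * l"
    using MVT[OF z, of G] d by (auto simp: real_differentiable_def)
  have "l = \<mu> * - (cyl_int (1 - \<mu>) (- w) - cyl_int 1 (- w))"
    using DERIV_unique[OF w(3) d[OF w(1)]] by (simp add: algebra_simps)
  then have "\<bar>l\<bar> = \<mu> * \<bar>cyl_int (1 - \<mu>) (- w) - cyl_int 1 (- w)\<bar>"
    using \<mu> by (simp only: abs_mult abs_minus_cancel abs_of_nonneg)
  also have "\<dots> \<le> \<mu> * (2 * \<mu> * cyl_bound z)"
    using \<mu> w by (intro mult_left_mono cyl_order_bound') auto
  finally have "z * \<bar>l\<bar> \<le> z * (\<mu> * (2 * \<mu> * cyl_bound z))"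
    using z by (intro mult_left_mono) auto
  moreover have "G 0 = cyl_int (2 - \<mu>) 0"
    by (simp add: G_def cyl_A_def cyl_N_def)
  then have "cyl_A (1 - \<mu>) (- z) - (cyl_int (2 - \<mu>) 0 - \<mu> * cyl_N z) = z * l"
    using w(4) by (simp add: G_def)
  then have "\<bar>cyl_A (1 - \<mu>) (- z) - (cyl_int (2 - \<mu>) 0 - \<mu> * cyl_N z)\<bar> = z * \<bar>l\<bar>"
    using z by (simp add: abs_mult)
  ultimately show ?thesis
    by (simp add: power2_eq_square mult_ac)
qed

section \<open>Gaussian asymptotics\<close>

lemma gaussian_integral:
  shows "integrable lborel (\<lambda>u::real. exp (- (u^2 / 2)))"
    and "(LINT u|lborel. exp (- (u^2 / 2))) = sqrt (2 * pi)"
proof -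
  have e: "exp (- (u^2 / 2)) = sqrt (2 * pi) * std_normal_density u" for u
    by (simp add: std_normal_density_def)
  show "integrable lborel (\<lambda>u::real. exp (- (u^2 / 2)))"
    unfolding e by (intro integrable_mult_right) simp
  show "(LINT u|lborel. exp (- (u^2 / 2))) = sqrt (2 * pi)"
    unfolding e by simp
qed

text \<open>Substituting t = -y - u completes the square; this is the source of the Gaussian
  integral in the final formula.\<close>

lemma cyl_int_1: "cyl_int 1 y = exp (y^2 / 2) * (LINT u:{..- y}|lborel. exp (- (u^2 / 2)))"
proof -
  have "cyl_int 1 y = (LINT t|lborel. indicator {0<..} t *\<^sub>R exp (- y * t - t^2 / 2))"
    unfolding cyl_int_def set_lebesgue_integral_def
    by (intro Bochner_Integration.integral_cong) (auto simp: kern_def split: split_indicator)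
  also have "\<dots> = (LINT u|lborel. indicator {0<..} (- y + (- 1) * u) *\<^sub>R exp (- y * (- y + (- 1) * u) - (- y + (- 1) * u)^2 / 2))"
    by (subst lborel_integral_real_affine[where c = "- 1" and t = "- y"]) auto
  also have "\<dots> = (LINT u|lborel. exp (y^2 / 2) * (indicator {..- y} u *\<^sub>R exp (- (u^2 / 2))))"
  proof (rule integral_cong_AE)
    have e: "exp (- y * (- y + (- 1) * u) - (- y + (- 1) * u)^2 / 2) = exp (y^2 / 2) * exp (- (u^2 / 2))" for u
      by (simp add: power2_eq_square field_simps flip: exp_add)
    \<comment> \<open>The two indicators differ only at u = -y.\<close>
    have "AE u in lborel. u \<noteq> - y" by (rule AE_lborel_singleton)
    then show "AE u in lborel. indicator {0<..} (- y + (- 1) * u) *\<^sub>R exp (- y * (- y + (- 1) * u) - (- y + (- 1) * u)^2 / 2)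
       = exp (y^2 / 2) * (indicator {..- y} u *\<^sub>R exp (- (u^2 / 2)))"
      unfolding e by eventually_elim (auto split: split_indicator)
  qed auto
  finally show ?thesis
    by (simp add: set_lebesgue_integral_def)
qed

lemma cyl_int_1_asymp: "((\<lambda>z. cyl_int 1 (- z) / exp (z^2 / 2)) \<longlongrightarrow> sqrt (2 * pi)) at_top"
proof -
  have "((\<lambda>z. LINT u|lborel. indicator {..z} u *\<^sub>R exp (- (u^2 / 2))) \<longlongrightarrow> sqrt (2 * pi)) at_top"
    using tendsto_integral_at_top[OF _ gaussian_integral(1)] gaussian_integral(2) by simp
  then show ?thesis
    by (simp add: cyl_int_1 set_lebesgue_integral_def)
qed

text \<open>L'Hospital's rule: the comparison function has derivative exp (z^2/2) (1 - 1/z^2), of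
  the same order as \<open>cyl_int 1 (- z)\<close>.\<close>

lemma cyl_N_asymp: "((\<lambda>z. cyl_N z / (exp (z^2 / 2) / z)) \<longlongrightarrow> sqrt (2 * pi)) at_top"
proof (rule lhospital_at_top_at_top)
  show "filterlim (\<lambda>z::real. exp (z^2 / 2) / z) at_top at_top"
    by real_asymp
  show "\<forall>\<^sub>F z::real in at_top. exp (z^2 / 2) * (1 - 1 / z^2) \<noteq> 0"
    using eventually_gt_at_top[of "1::real"]
    by eventually_elim (auto simp: field_simps power2_eq_1_iff)
  show "\<forall>\<^sub>F z in at_top. (cyl_N has_real_derivative cyl_int 1 (- z)) (at z)"
    using eventually_gt_at_top[of "0::real"] by eventually_elim (rule cyl_N_deriv)
  show "\<forall>\<^sub>F z::real in at_top. ((\<lambda>z. exp (z^2 / 2) / z) has_real_derivative exp (z^2 / 2) * (1 - 1 / z^2)) (at z)"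
    using eventually_gt_at_top[of "0::real"]
    by eventually_elim (auto intro!: derivative_eq_intros simp: field_simps power2_eq_square)
  have "((\<lambda>z::real. 1 - 1 / z^2) \<longlongrightarrow> 1) at_top" by real_asymp
  from tendsto_divide[OF cyl_int_1_asymp this]
  show "((\<lambda>z. cyl_int 1 (- z) / (exp (z^2 / 2) * (1 - 1 / z^2))) \<longlongrightarrow> sqrt (2 * pi)) at_top"
    by simp
qed

text \<open>With \<open>z = - \<beta> / sqrt \<eta>\<close>, the leading term of \<open>r / \<eta> - 1\<close>.\<close>

definition gap_term :: "real \<Rightarrow> real \<Rightarrow> real" where
  "gap_term \<beta> z = cyl_int 2 (- \<beta>) * z * exp (- (z^2 / 2)) / sqrt (2 * pi)"

text \<open>For \<mu> = \<kappa> \<open>gap_term \<beta> z\<close>, both \<mu>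
  \<open>cyl_N z\<close> and (\<mu> / z) \<open>cyl_int (1 - \<mu>) (- z)\<close> tend to \<kappa>
  q, and sqrt \<eta> = -\<beta> / z. The identity \<open>qC\<close> merges the two contributions
  into the single factor 1 - \<kappa>.\<close>

lemma char_fun_limit:
  assumes \<beta>: "\<beta> < 0" and \<kappa>: "\<kappa> > 0"
  shows "((\<lambda>z. char_fun \<beta> (\<beta>^2 / z^2) (\<kappa> * gap_term \<beta> z)) \<longlongrightarrow> cyl_int 2 (- \<beta>) * (1 - \<kappa>)) at_top"
proof -
  define q C where "q = cyl_int 2 (- \<beta>)" and "C = cyl_int 1 (- \<beta>)"
  have q: "q > 0" unfolding q_def by (rule cyl_pos) simp
  have qC: "q + (- \<beta>) * C = 1" using cyl_rec0[of "- \<beta>"] by (simp add: q_def C_def)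
  define m where "m = (\<lambda>z. \<kappa> * gap_term \<beta> z)"
  define k where "k = \<kappa> * q / sqrt (2 * pi)"
  have k: "k > 0" using q \<kappa> by (simp add: k_def)
  have m_eq: "m z = k * z * exp (- (z^2 / 2))" for z
    by (simp add: m_def gap_term_def k_def q_def)
  have m0: "(m \<longlongrightarrow> 0) at_top" unfolding m_eq[abs_def] by real_asymp
  define g :: real where "g = Gamma (1 / 2) + Gamma 2"
  have g: "g > 0" unfolding g_def by (intro add_pos_pos Gamma_real_pos) auto
  \<comment> \<open>The square of m decays like z^2 exp (- z^2) against exp ((1 + z)^2 / 2) in
    \<open>cyl_bound\<close>, which leaves exp (z - z^2/2) up to powers of z.\<close>
  have err1: "((\<lambda>z. 2 * (m z)^2 * (z * cyl_bound z)) \<longlongrightarrow> 0) at_top"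
    unfolding m_eq cyl_bound_def g_def[symmetric] using g k by real_asymp
  have err2: "((\<lambda>z. m z / z * (2 * m z * cyl_bound z)) \<longlongrightarrow> 0) at_top"
    unfolding m_eq cyl_bound_def g_def[symmetric] using g k by real_asymp
  have m_half: "\<forall>\<^sub>F z in at_top. 0 \<le> m z \<and> m z \<le> 1 / 2 \<and> 0 < z"
    using eventually_conj[OF order_tendstoD(2)[OF m0, of "1 / 2"] eventually_gt_at_top[of 0]] k
    by (auto elim!: eventually_mono simp: m_eq)
  have Acont: "((\<lambda>z. cyl_int (2 - m z) 0) \<longlongrightarrow> 1) at_top"
  proof -
    have "((\<lambda>z. cyl_int (2 - m z) 0) \<longlongrightarrow> cyl_int 2 0) at_top"
      by (rule isCont_tendsto_compose[OF isCont_cyl_order]) (use m0 in \<open>auto intro!: tendsto_eq_intros\<close>)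
    then show ?thesis using cyl_rec0[of 0] by simp
  qed
  have mN: "((\<lambda>z. m z * cyl_N z) \<longlongrightarrow> \<kappa> * q) at_top"
  proof -
    have "((\<lambda>z. k * (cyl_N z / (exp (z^2 / 2) / z))) \<longlongrightarrow> k * sqrt (2 * pi)) at_top"
      by (intro tendsto_intros cyl_N_asymp)
    moreover have "k * (cyl_N z / (exp (z^2 / 2) / z)) = m z * cyl_N z" for z
      by (simp add: m_eq exp_minus field_simps)
    ultimately show ?thesis by (simp add: k_def)
  qed
  have A: "((\<lambda>z. cyl_A (1 - m z) (- z)) \<longlongrightarrow> 1 - \<kappa> * q) at_top"
  proof (rule Lim_transform)
    show "((\<lambda>z. cyl_int (2 - m z) 0 - m z * cyl_N z) \<longlongrightarrow> 1 - \<kappa> * q) at_top"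
      by (intro tendsto_diff Acont mN)
    show "((\<lambda>z. cyl_A (1 - m z) (- z) - (cyl_int (2 - m z) 0 - m z * cyl_N z)) \<longlongrightarrow> 0) at_top"
      by (rule Lim_null_comparison[OF _ err1])
         (use m_half in \<open>auto elim!: eventually_mono intro!: cyl_A_bound\<close>)
  qed
  have K: "((\<lambda>z. m z / z * cyl_int (1 - m z) (- z)) \<longlongrightarrow> \<kappa> * q) at_top"
  proof (rule Lim_transform)
    have "((\<lambda>z. k * (cyl_int 1 (- z) / exp (z^2 / 2))) \<longlongrightarrow> k * sqrt (2 * pi)) at_top"
      by (intro tendsto_intros cyl_int_1_asymp)
    then have "((\<lambda>z. k * (cyl_int 1 (- z) / exp (z^2 / 2))) \<longlongrightarrow> \<kappa> * q) at_top"
      by (simp add: k_def)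
    then show "((\<lambda>z. m z / z * cyl_int 1 (- z)) \<longlongrightarrow> \<kappa> * q) at_top"
      by (rule Lim_transform_eventually)
         (use eventually_gt_at_top[of 0] in eventually_elim, simp add: m_eq exp_minus field_simps)
    show "((\<lambda>z. m z / z * cyl_int (1 - m z) (- z) - m z / z * cyl_int 1 (- z)) \<longlongrightarrow> 0) at_top"
    proof (rule Lim_null_comparison[OF _ err2])
      show "\<forall>\<^sub>F z in at_top. norm (m z / z * cyl_int (1 - m z) (- z) - m z / z * cyl_int 1 (- z))
          \<le> m z / z * (2 * m z * cyl_bound z)"
        using m_half
      proof eventually_elim
        case (elim z)
        have "norm (m z / z * cyl_int (1 - m z) (- z) - m z / z * cyl_int 1 (- z))
            = m z / z * \<bar>cyl_int (1 - m z) (- z) - cyl_int 1 (- z)\<bar>"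
          using elim by (simp only: right_diff_distrib[symmetric] real_norm_def abs_mult abs_divide abs_of_nonneg abs_of_pos)
        also have "\<dots> \<le> m z / z * (2 * m z * cyl_bound z)"
          using elim by (intro mult_left_mono cyl_order_bound') auto
        finally show ?case .
      qed
    qed
  qed
  have lam0: "((\<lambda>z. \<beta>^2 / z^2 * (1 + m z)) \<longlongrightarrow> 0) at_top"
    unfolding m_eq by real_asymp
  have K2: "((\<lambda>z. cyl_int (2 - \<beta>^2 / z^2 * (1 + m z)) (- \<beta>)) \<longlongrightarrow> q) at_top"
    unfolding q_def
    by (rule isCont_tendsto_compose[OF isCont_cyl_order]) (use tendsto_diff[OF tendsto_const lam0] in auto)
  have K1: "((\<lambda>z. cyl_int (1 - \<beta>^2 / z^2 * (1 + m z)) (- \<beta>)) \<longlongrightarrow> C) at_top"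
    unfolding C_def
    by (rule isCont_tendsto_compose[OF isCont_cyl_order]) (use tendsto_diff[OF tendsto_const lam0] in auto)
  have "((\<lambda>z. cyl_A (1 - m z) (- z) * cyl_int (2 - \<beta>^2 / z^2 * (1 + m z)) (- \<beta>)
      - (- \<beta>) * (m z / z * cyl_int (1 - m z) (- z)) * cyl_int (1 - \<beta>^2 / z^2 * (1 + m z)) (- \<beta>))
      \<longlongrightarrow> (1 - \<kappa> * q) * q - (- \<beta>) * (\<kappa> * q) * C) at_top"
    by (intro tendsto_diff tendsto_mult tendsto_const A K K1 K2)
  also have "(1 - \<kappa> * q) * q - (- \<beta>) * (\<kappa> * q) * C = q * (1 - \<kappa> * (q + (- \<beta>) * C))"
    by (simp add: algebra_simps)
  also have "\<dots> = q * (1 - \<kappa>)"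
    unfolding qC by simp
  finally show ?thesis
    unfolding q_def[symmetric]
  proof (rule Lim_transform_eventually)
    show "\<forall>\<^sub>F z in at_top. cyl_A (1 - m z) (- z) * cyl_int (2 - \<beta>^2 / z^2 * (1 + m z)) (- \<beta>)
        - (- \<beta>) * (m z / z * cyl_int (1 - m z) (- z)) * cyl_int (1 - \<beta>^2 / z^2 * (1 + m z)) (- \<beta>)
        = char_fun \<beta> (\<beta>^2 / z^2) (\<kappa> * gap_term \<beta> z)"
      using eventually_gt_at_top[of 0]
    proof eventually_elim
      case (elim z)
      have "sqrt (\<beta>^2 / z^2) = - \<beta> / z"
        using elim \<beta> by (simp add: real_sqrt_divide)
      then show ?case
        using elim \<beta> by (simp add: char_fun_def m_def)
    qed
  qed
qed

section \<open>Locating the gap\<close>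

lemma gap_term_pos: "z > 0 \<Longrightarrow> gap_term \<beta> z > 0"
  unfolding gap_term_def by (intro divide_pos_pos mult_pos_pos cyl_pos) auto

lemma gap_term_tendsto_0: "(gap_term \<beta> \<longlongrightarrow> 0) at_top"
proof -
  define q where "q = cyl_int 2 (- \<beta>)"
  show ?thesis
    unfolding gap_term_def[abs_def] q_def[symmetric] by real_asymp
qed

text \<open>Taking \<kappa> = 1 - \<epsilon> and \<kappa> = 1 + \<epsilon> in
  \<open>char_fun_limit\<close> gives opposite signs, so \<open>spectral_gap_between\<close> traps
  \<mu> between these multiples of the leading term.\<close>

lemma spectral_gap_bounds:
  assumes \<beta>: "\<beta> < 0" and \<epsilon>: "0 < \<epsilon>" "\<epsilon> < 1"
  shows "\<forall>\<^sub>F \<eta> in at_right 0. \<bar>(spectral_gap \<beta> \<eta> - \<eta>) / (\<eta> * gap_term \<beta> (- \<beta> / sqrt \<eta>)) - 1\<bar> < \<epsilon>"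
proof -
  have q: "cyl_int 2 (- \<beta>) > 0" by (rule cyl_pos) simp
  have z: "filterlim (\<lambda>\<eta>. - \<beta> / sqrt \<eta>) at_top (at_right 0)"
    using \<beta> by real_asymp
  have "\<forall>\<^sub>F z in at_top. char_fun \<beta> (\<beta>^2 / z^2) ((1 - \<epsilon>) * gap_term \<beta> z) > 0"
    using \<epsilon> q by (intro order_tendstoD(1)[OF char_fun_limit[OF \<beta>]]) auto
  moreover have "\<forall>\<^sub>F z in at_top. char_fun \<beta> (\<beta>^2 / z^2) ((1 + \<epsilon>) * gap_term \<beta> z) < 0"
    using \<epsilon> q by (intro order_tendstoD(2)[OF char_fun_limit[OF \<beta>]]) (auto simp: mult_pos_neg)
  moreover have "\<forall>\<^sub>F z in at_top. (1 + \<epsilon>) * gap_term \<beta> z < 1"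
    by (rule order_tendstoD(2)[OF tendsto_mult_right_zero[OF gap_term_tendsto_0]]) simp
  ultimately have "\<forall>\<^sub>F z in at_top. char_fun \<beta> (\<beta>^2 / z^2) ((1 - \<epsilon>) * gap_term \<beta> z) > 0 \<and>
      char_fun \<beta> (\<beta>^2 / z^2) ((1 + \<epsilon>) * gap_term \<beta> z) < 0 \<and> (1 + \<epsilon>) * gap_term \<beta> z < 1"
    by eventually_elim simp
  note ev = eventually_compose_filterlim[OF this z]
  have small: "\<forall>\<^sub>F \<eta> in at_right 0. 0 < \<eta> \<and> 2 * \<eta> < (1::real)"
    unfolding eventually_at_right_field by (intro exI[of _ "1 / 2"]) auto
  show ?thesis
    using ev small
  proof eventually_elim
    case (elim \<eta>)
    define z where "z = - \<beta> / sqrt \<eta>"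
    define G where "G = gap_term \<beta> z"
    have z: "z > 0" "\<beta>^2 / z^2 = \<eta>"
      unfolding z_def using elim \<beta> by (auto simp: power_divide intro: divide_neg_pos)
    have G: "G > 0" unfolding G_def by (rule gap_term_pos[OF z(1)])
    have "char_fun \<beta> \<eta> ((1 - \<epsilon>) * G) > 0" "char_fun \<beta> \<eta> ((1 + \<epsilon>) * G) < 0" "(1 + \<epsilon>) * G < 1"
      using elim unfolding z_def[symmetric] G_def z(2) by auto
    then obtain \<mu> where \<mu>: "(1 - \<epsilon>) * G < \<mu>" "\<mu> < (1 + \<epsilon>) * G" "spectral_gap \<beta> \<eta> = \<eta> * (1 + \<mu>)"
      using spectral_gap_between[of \<beta> \<eta> "(1 - \<epsilon>) * G" "(1 + \<epsilon>) * G"] \<beta> elim \<epsilon> G by auto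
    have "(spectral_gap \<beta> \<eta> - \<eta>) / (\<eta> * G) = \<mu> / G"
      using elim G unfolding \<mu>(3) by (simp add: field_simps)
    moreover have "1 - \<epsilon> < \<mu> / G" "\<mu> / G < 1 + \<epsilon>"
      using \<mu> G by (simp_all add: pos_less_divide_eq pos_divide_less_eq)
    ultimately show ?case
      unfolding z_def[symmetric] G_def[symmetric] by (simp add: abs_less_iff)
  qed
qed

lemma spectral_gap_correction:
  assumes "\<beta> < 0"
  shows "((\<lambda>\<eta>. (spectral_gap \<beta> \<eta> - \<eta>) / (\<eta> * gap_term \<beta> (- \<beta> / sqrt \<eta>))) \<longlongrightarrow> 1) (at_right 0)"
proof (rule tendstoI)
  fix e :: real assume "e > 0"
  then have "\<forall>\<^sub>F \<eta> in at_right 0. \<bar>(spectral_gap \<beta> \<eta> - \<eta>) / (\<eta> * gap_term \<beta> (- \<beta> / sqrt \<eta>)) - 1\<bar> < min e (1 / 2)"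
    by (intro spectral_gap_bounds[OF assms]) auto
  then show "\<forall>\<^sub>F \<eta> in at_right 0. dist ((spectral_gap \<beta> \<eta> - \<eta>) / (\<eta> * gap_term \<beta> (- \<beta> / sqrt \<eta>))) 1 < e"
    by eventually_elim (simp add: dist_real_def)
qed

text \<open>By \<open>cyl_rec0\<close> and \<open>cyl_int_1\<close> the bracket is
  \<open>cyl_int 2 (- \<beta>)\<close>; in particular it is positive.\<close>

lemma gap_term_eq:
  assumes "\<eta> > 0"
  shows "\<eta> * gap_term \<beta> (- \<beta> / sqrt \<eta>) = - (\<beta> * sqrt \<eta> / sqrt (2 * pi)) * exp (- (\<beta>^2 / (2 * \<eta>))) *
             (1 + \<beta> * exp (\<beta>^2 / 2) * (LINT u:{..\<beta>}|lborel. exp (- (u^2 / 2))))"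
proof -
  have K: "cyl_int 2 (- \<beta>) = 1 + \<beta> * exp (\<beta>^2 / 2) * (LINT u:{..\<beta>}|lborel. exp (- (u^2 / 2)))"
    using cyl_rec0[of "- \<beta>"] cyl_int_1[of "- \<beta>"] by simp
  have z: "\<eta> * (- \<beta> / sqrt \<eta>) = - (\<beta> * sqrt \<eta>)"
    using assms by (simp add: field_simps flip: real_sqrt_mult)
  have e: "(- \<beta> / sqrt \<eta>)^2 / 2 = \<beta>^2 / (2 * \<eta>)"
    using assms by (simp add: power_divide)
  have "\<eta> * gap_term \<beta> (- \<beta> / sqrt \<eta>) = \<eta> * (- \<beta> / sqrt \<eta>) / sqrt (2 * pi) * exp (- ((- \<beta> / sqrt \<eta>)^2 / 2)) * cyl_int 2 (- \<beta>)"
    unfolding gap_term_def by simp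
  then show ?thesis
    unfolding z e K by simp
qed

theorem proposition4:
  fixes \<beta> :: real
  assumes "\<beta> < 0"
  shows "(\<lambda>\<eta>. spectral_gap \<beta> \<eta>) \<sim>[at_right 0] (\<lambda>\<eta>. \<eta>)
      \<and> (\<lambda>\<eta>. spectral_gap \<beta> \<eta> - \<eta>) \<sim>[at_right 0]
           (\<lambda>\<eta>. - (\<beta> * sqrt \<eta> / sqrt (2 * pi)) * exp (- (\<beta>^2 / (2 * \<eta>))) *
             (1 + \<beta> * exp (\<beta>^2 / 2) * (LINT u:{..\<beta>}|lborel. exp (- (u^2 / 2)))))
      \<and> (\<exists>c>0. (\<lambda>\<eta>. spectral_gap \<beta> \<eta> - \<eta>) \<in> O[at_right 0](\<lambda>\<eta>. exp (- (c / \<eta>))))"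
proof -
  define J where "J = 1 + \<beta> * exp (\<beta>^2 / 2) * (LINT u:{..\<beta>}|lborel. exp (- (u^2 / 2)))"
  define T where "T = (\<lambda>\<eta>. - (\<beta> * sqrt \<eta> / sqrt (2 * pi)) * exp (- (\<beta>^2 / (2 * \<eta>))) * J)"
  have pos: "\<forall>\<^sub>F \<eta> in at_right 0. (0::real) < \<eta>"
    by (simp add: eventually_at_right_less)
  have T: "\<eta> * gap_term \<beta> (- \<beta> / sqrt \<eta>) = T \<eta>" if "\<eta> > 0" for \<eta>
    unfolding T_def J_def by (rule gap_term_eq[OF that])
  have ratio: "((\<lambda>\<eta>. (spectral_gap \<beta> \<eta> - \<eta>) / T \<eta>) \<longlongrightarrow> 1) (at_right 0)"
    using spectral_gap_correction[OF assms]
  proof (rule Lim_transform_eventually)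
    show "\<forall>\<^sub>F \<eta> in at_right 0. (spectral_gap \<beta> \<eta> - \<eta>) / (\<eta> * gap_term \<beta> (- \<beta> / sqrt \<eta>))
        = (spectral_gap \<beta> \<eta> - \<eta>) / T \<eta>"
      using pos by eventually_elim (simp only: T)
  qed
  have corr: "(\<lambda>\<eta>. spectral_gap \<beta> \<eta> - \<eta>) \<sim>[at_right 0] T"
    by (rule asymp_equivI'[OF ratio])
  have z: "filterlim (\<lambda>\<eta>. - \<beta> / sqrt \<eta>) at_top (at_right 0)"
    using assms by real_asymp
  \<comment> \<open>The quotient r / \<eta> is 1 plus the correction ratio times
    \<open>gap_term\<close>, and the last factor tends to 0.\<close>
  have "((\<lambda>\<eta>. 1 + (spectral_gap \<beta> \<eta> - \<eta>) / (\<eta> * gap_term \<beta> (- \<beta> / sqrt \<eta>)) * gap_term \<beta> (- \<beta> / sqrt \<eta>))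
      \<longlongrightarrow> 1 + 1 * 0) (at_right 0)"
    by (intro tendsto_intros spectral_gap_correction[OF assms] filterlim_compose[OF gap_term_tendsto_0 z])
  then have "((\<lambda>\<eta>. 1 + (spectral_gap \<beta> \<eta> - \<eta>) / (\<eta> * gap_term \<beta> (- \<beta> / sqrt \<eta>)) * gap_term \<beta> (- \<beta> / sqrt \<eta>))
      \<longlongrightarrow> 1) (at_right 0)"
    by simp
  then have "((\<lambda>\<eta>. spectral_gap \<beta> \<eta> / \<eta>) \<longlongrightarrow> 1) (at_right 0)"
  proof (rule Lim_transform_eventually)
    show "\<forall>\<^sub>F \<eta> in at_right 0. 1 + (spectral_gap \<beta> \<eta> - \<eta>) / (\<eta> * gap_term \<beta> (- \<beta> / sqrt \<eta>)) * gap_term \<beta> (- \<beta> / sqrt \<eta>)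
        = spectral_gap \<beta> \<eta> / \<eta>"
      using pos
    proof eventually_elim
      case (elim \<eta>)
      then have "gap_term \<beta> (- \<beta> / sqrt \<eta>) > 0"
        using assms by (intro gap_term_pos divide_pos_pos) auto
      then show ?case using elim by (simp add: field_simps)
    qed
  qed
  then have main: "(\<lambda>\<eta>. spectral_gap \<beta> \<eta>) \<sim>[at_right 0] (\<lambda>\<eta>. \<eta>)"
    by (rule asymp_equivI')
  \<comment> \<open>The rate c = \<beta>^2 / 2 is read off from T; the remaining factor tends to 0
    with sqrt \<eta>.\<close>
  have "T \<in> O[at_right 0](\<lambda>\<eta>. exp (- (\<beta>^2 / 2 / \<eta>)))"
  proof (rule bigoI_tendsto)
    have "((\<lambda>\<eta>. - (\<beta> * sqrt \<eta> / sqrt (2 * pi)) * J) \<longlongrightarrow> - (\<beta> * sqrt 0 / sqrt (2 * pi)) * J) (at_right 0)"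
      by (intro tendsto_intros) auto
    moreover have "T \<eta> / exp (- (\<beta>^2 / 2 / \<eta>)) = - (\<beta> * sqrt \<eta> / sqrt (2 * pi)) * J" for \<eta>
      by (simp add: T_def)
    ultimately show "((\<lambda>\<eta>. T \<eta> / exp (- (\<beta>^2 / 2 / \<eta>))) \<longlongrightarrow> 0) (at_right 0)"
      by simp
  qed simp
  then have "(\<lambda>\<eta>. spectral_gap \<beta> \<eta> - \<eta>) \<in> O[at_right 0](\<lambda>\<eta>. exp (- (\<beta>^2 / 2 / \<eta>)))"
    using landau_o.big_trans[OF asymp_equiv_imp_bigo[OF corr]] by blast
  moreover have "\<beta>^2 / 2 > 0" using assms by simp
  ultimately show ?thesis
    using main corr unfolding T_def J_def by blast
qed

end
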